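(* Let $p\ge 3$ be an integer and let $X\sim N_p(\theta,I_p)$ with unknown $\theta\in\mathbb{R}^p$. For $\alpha\ge 1$ let $$\delta_\alpha(x)=\left(1-\frac{\phi_\alpha(\|x\|^2)}{\|x\|^2}\right)x,\qquad \phi_\alpha(w)=w\,\frac{\int_0^1\lambda^{\alpha(p/2-1)}\exp(-w\alpha\lambda/2)\,d\lambda}{\int_0^1\lambda^{\alpha(p/2-1)-1}\exp(-w\alpha\lambda/2)\,d\lambda},$$ and let $\delta_{JS}(x)=\left(1-\frac{p-2}{\|x\|^2}\right)x$ and $\delta_{JS}^+(x)=\max\left(0,1-\frac{p-2}{\|x\|^2}\right)x$, for $x\in\mathbb{R}^p\setminus\{0\}$. Then: 1. For every $\alpha\ge 1$, $\delta_\alpha(X)$ dominates $\delta_{JS}(X)$. 2. For every $\alpha>1$, the risk of $\delta_\alpha$ at $\theta=0$ is strictly less than the risk of $\delta_{JS}$ at $\theta=0$, i.e. $R(0,\delta_\alpha)<R(0,\delta_{JS})$. 3. $\lim_{\alpha\to\infty}\delta_\alpha(x)=\delta_{JS}^+(x)$ for every $x\in\mathbb{R}^p\setminus\{0\}$.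
   Context: $\|\cdot\|$ is the Euclidean norm. The risk of an estimator $\delta$ of $\theta$ is $R(\theta,\delta)=E_\theta\left[\|\delta(X)-\theta\|^2\right]$, where $X\sim N_p(\theta,I_p)$. An estimator $\delta$ dominates an estimator $\delta'$ if $R(\theta,\delta)\le R(\theta,\delta')$ for all $\theta\in\mathbb{R}^p$, with strict inequality for some $\theta$. Estimators need only be defined for $x\ne 0$, since $X=0$ has probability zero. *)

theory Defs
  imports "HOL-Probability.Probability"
begin

text \<open>The law \<open>N_p(\<theta>, I_p)\<close> on \<open>\<real>\<^sup>p\<close>, with \<open>p = CARD('n)\<close>: independent
  coordinates, the \<open>i\<close>-th one normal with mean \<open>\<theta> $ i\<close> and variance 1.\<close>

definition normal_vec :: "real ^ 'n \<Rightarrow> (real ^ 'n) measure" where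
  "normal_vec \<theta> =
     density lborel (\<lambda>x. ennreal (\<Prod>i\<in>UNIV. normal_density (\<theta> $ i) 1 (x $ i)))"

text \<open>The expectation is taken in \<open>[0, \<infinity>]\<close>, so that an estimator with non-integrable loss has
  infinite risk (the Bochner integral would give it risk 0).\<close>

definition risk :: "real ^ 'n \<Rightarrow> (real ^ 'n \<Rightarrow> real ^ 'n) \<Rightarrow> ennreal" where
  "risk \<theta> \<delta> = (\<integral>\<^sup>+ x. ennreal ((norm (\<delta> x - \<theta>))\<^sup>2) \<partial>normal_vec \<theta>)"

definition dominates :: "(real ^ 'n \<Rightarrow> real ^ 'n) \<Rightarrow> (real ^ 'n \<Rightarrow> real ^ 'n) \<Rightarrow> bool" where
  "dominates \<delta> \<delta>' \<longleftrightarrow>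
     (\<forall>\<theta>. risk \<theta> \<delta> \<le> risk \<theta> \<delta>') \<and> (\<exists>\<theta>. risk \<theta> \<delta> < risk \<theta> \<delta>')"

definition phi :: "nat \<Rightarrow> real \<Rightarrow> real \<Rightarrow> real" where
  "phi p \<alpha> w =
     w * ((LINT l:{0..1}|lborel. l powr (\<alpha> * (real p / 2 - 1)) * exp (- (w * \<alpha> * l / 2)))
        / (LINT l:{0..1}|lborel. l powr (\<alpha> * (real p / 2 - 1) - 1) * exp (- (w * \<alpha> * l / 2))))"

text \<open>The estimators below are meant for \<open>x \<noteq> 0\<close>. At \<open>x = 0\<close>, a null set for every
  \<open>normal_vec \<theta>\<close>, they take the value 0.\<close>

definition delta :: "real \<Rightarrow> real ^ 'n \<Rightarrow> real ^ 'n" where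
  "delta \<alpha> x = (1 - phi CARD('n) \<alpha> ((norm x)\<^sup>2) / (norm x)\<^sup>2) *\<^sub>R x"

definition delta_JS :: "real ^ 'n \<Rightarrow> real ^ 'n" where
  "delta_JS x = (1 - (real CARD('n) - 2) / (norm x)\<^sup>2) *\<^sub>R x"

definition delta_JS_plus :: "real ^ 'n \<Rightarrow> real ^ 'n" where
  "delta_JS_plus x = max 0 (1 - (real CARD('n) - 2) / (norm x)\<^sup>2) *\<^sub>R x"

end

theory Submission
  imports Defs "HOL-Real_Asymp.Real_Asymp"
begin

text \<open>Write \<open>c = p - 2\<close>, \<open>w = (norm x)\<^sup>2\<close> and \<open>h\<^sub>\<alpha> = c - phi p \<alpha>\<close>, so that \<open>h\<^sub>\<alpha> = 0\<close> gives \<open>delta_JS\<close>. An integration by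
  parts yields \<open>h\<^sub>\<alpha> = 2 g / (\<alpha> G)\<close> with \<open>g(s) = s\<^bsup>\<alpha>c/2\<^esup> e\<^bsup>-\<alpha>s/2\<^esup>\<close> and \<open>G' = g / s\<close>, \<open>G(0) = 0\<close>; from this,
  \<open>h\<^sub>\<alpha>\<close> solves a Riccati equation, is strictly decreasing, lies between \<open>max 0 (c - s)\<close> and \<open>c\<close>, and
  decreases strictly with \<open>\<alpha>\<close> from the extremal \<open>h\<^sub>1\<close>.

  The risks are compared line by line through the origin, which replaces Kubokawa's integral expression of
  the risk difference and the noncentral chi-square distribution. In polar coordinates,
  symmetrised under \<open>x \<mapsto> - x\<close>, the difference of the two losses times the density is, on every line,
  the derivative of a function vanishing at both ends minus a nonnegative remainder. The remainder is
  nonnegative because \<open>h\<^sub>\<alpha>\<close> is decreasing and \<open>h\<^sub>\<alpha> \<le> h\<^sub>1\<close>, and it is positive if \<open>\<alpha> > 1\<close> or if \<open>\<theta>\<close> is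
  not orthogonal to the line.\<close>

section \<open>The shrinkage function\<close>

text \<open>\<open>gam a c s / s\<close> is the unnormalised density of the Gamma distribution with
  shape a c / 2 and rate a / 2; for a = 1 this is chi-square with c degrees of freedom.\<close>

definition gam :: "real \<Rightarrow> real \<Rightarrow> real \<Rightarrow> real" where
  "gam a c s = s powr (a * c / 2) * exp (- (a * s / 2))"

definition Gam :: "real \<Rightarrow> real \<Rightarrow> real \<Rightarrow> real" where
  "Gam a c s = integral {0..s} (\<lambda>w. gam a c w / w)"

text \<open>With \<open>c = p - 2\<close>, \<open>gap a c w\<close> is \<open>p - 2 - phi p a w\<close>, rewritten by an integration by parts
  (see \<open>phi_eq\<close>).\<close>

definition gap :: "real \<Rightarrow> real \<Rightarrow> real \<Rightarrow> real" where
  "gap a c s = 2 * gam a c s / (a * Gam a c s)"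

section \<open>Calculus of \<open>gam\<close> and \<open>Gam\<close>\<close>

lemma gam_pos: "s > 0 \<Longrightarrow> gam a c s > 0"
  by (simp add: gam_def)

lemma gam_nonneg: "gam a c s \<ge> 0"
  by (simp add: gam_def)

lemma gam_0 [simp]: "gam a c 0 = 0"
  by (simp add: gam_def)

lemma continuous_on_gam:
  assumes "a > 0" "c > 0" shows "continuous_on {0..} (gam a c)"
  unfolding gam_def using assms by (auto intro!: continuous_intros continuous_on_powr')

lemma gam_deriv:
  assumes "s > 0"
  shows "(gam a c has_real_derivative a / 2 * (c - s) * (gam a c s / s)) (at s)"
proof -
  have "s powr (a * c / 2 - 1) = s powr (a * c / 2) / s"
    using assms by (simp add: powr_diff)
  moreover have "(gam a c has_real_derivative
      a * c / 2 * s powr (a * c / 2 - 1) * exp (- (a * s / 2))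
      - a / 2 * (s powr (a * c / 2) * exp (- (a * s / 2)))) (at s)"
    unfolding gam_def using assms by (auto intro!: derivative_eq_intros)
  moreover have "a * c / 2 * (s powr (a * c / 2) / s) * exp (- (a * s / 2))
      - a / 2 * (s powr (a * c / 2) * exp (- (a * s / 2))) = a / 2 * (c - s) * (gam a c s / s)"
    using assms by (simp add: gam_def field_simps)
  ultimately show ?thesis
    by simp
qed

lemma gam_mult: "gam a c s * gam b c s = gam (a + b) c s"
proof -
  have "exp (- (a * s / 2)) * exp (- (b * s / 2)) = exp (- ((a + b) * s / 2))"
    by (simp add: exp_add[symmetric] algebra_simps add_divide_distrib)
  moreover have "s powr (a * c / 2) * s powr (b * c / 2) = s powr ((a + b) * c / 2)"
    by (simp add: powr_add[symmetric] algebra_simps add_divide_distrib)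
  ultimately show ?thesis
    unfolding gam_def by (metis mult.assoc mult.left_commute)
qed

text \<open>Integrate \<open>gam_deriv\<close> over \<open>{0..s}\<close> and solve for the term
  with factor c. Since \<open>gam a c w / w\<close> is unbounded near 0 if a c < 2, its
  integrability is part of the result; it comes from continuity of \<open>gam\<close> up to 0 and
  differentiability inside.\<close>

lemma Gam_integral_by_parts:
  assumes "a > 0" "c > 0" "s \<ge> 0"
  shows "((\<lambda>w. gam a c w / w) has_integral
           (2 / a * gam a c s + integral {0..s} (gam a c)) / c) {0..s}"
proof -
  have cont: "continuous_on {0..s} (gam a c)"
    using continuous_on_gam[OF assms(1,2)] by (rule continuous_on_subset) auto
  have "((\<lambda>w. a / 2 * (c - w) * (gam a c w / w)) has_integral gam a c s - gam a c 0) {0..s}"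
    by (rule fundamental_theorem_of_calculus_interior[OF \<open>s \<ge> 0\<close> cont])
      (use gam_deriv[of _ a c] in \<open>auto simp: has_real_derivative_iff_has_vector_derivative[symmetric]\<close>)
  from has_integral_mult_right[OF this, of "2/a"]
  have "((\<lambda>w. (c - w) * (gam a c w / w)) has_integral 2 / a * gam a c s) {0..s}"
    using assms by simp
  \<comment> \<open>Adding the integral of \<open>gam\<close> removes the part with factor -w. At w
    = 0 the integrands agree because \<open>gam a c 0 = 0\<close> and division by 0 gives 0.\<close>
  from has_integral_add[OF this integrable_integral[OF integrable_continuous_real[OF cont]]]
  have "((\<lambda>w. c * (gam a c w / w)) has_integral 2 / a * gam a c s + integral {0..s} (gam a c)) {0..s}"
    by (rule has_integral_eq[rotated]) (auto simp: diff_divide_distrib left_diff_distrib)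
  from has_integral_mult_right[OF this, of "1/c"] show ?thesis
    using assms by simp
qed

lemma integrable_gam_div:
  "a > 0 \<Longrightarrow> c > 0 \<Longrightarrow> s \<ge> 0 \<Longrightarrow> (\<lambda>w. gam a c w / w) integrable_on {0..s}"
  using Gam_integral_by_parts by blast

lemma Gam_0 [simp]: "Gam a c 0 = 0"
  by (simp add: Gam_def)

lemma Gam_identity:
  assumes "a > 0" "c > 0" "s \<ge> 0"
  shows "c * Gam a c s = 2 / a * gam a c s + integral {0..s} (gam a c)"
  using integral_unique[OF Gam_integral_by_parts[OF assms]] assms by (simp add: Gam_def)

lemma continuous_on_Gam:
  assumes "a > 0" "c > 0"
  shows "continuous_on {0..} (Gam a c)"
proof -
  have "continuous_on {0..s} (Gam a c)" if "s \<ge> 0" for s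
    using indefinite_integral_continuous_1[OF integrable_gam_div[OF assms that]]
    by (simp add: Gam_def)
  then have "continuous (at x within {0..}) (Gam a c)" if "x \<ge> 0" for x
  proof -
    have c: "continuous (at x within {0..x + 1}) (Gam a c)"
      using \<open>\<And>s. s \<ge> 0 \<Longrightarrow> continuous_on {0..s} (Gam a c)\<close>[of "x + 1"] that
      by (auto simp: continuous_on_eq_continuous_within)
    have "at x within {0..} = at x within {0..x + 1}"
      by (rule at_within_nhd[of _ "{..< x + 1}"]) auto
    with c show ?thesis by simp
  qed
  then show ?thesis
    by (auto simp: continuous_on_eq_continuous_within)
qed

lemma Gam_deriv:
  assumes "a > 0" "c > 0" "s > 0"
  shows "(Gam a c has_real_derivative gam a c s / s) (at s)"
proof -
  \<comment> \<open>Starting at s/2 keeps the integrand continuous; the integral over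
    \<open>{0..s/2}\<close> enters as a constant.\<close>
  have cont: "continuous_on {s/2..s+1} (\<lambda>w. gam a c w / w)"
    using assms by (intro continuous_intros continuous_on_subset[OF continuous_on_gam]) auto
  have "((\<lambda>x. integral {s/2..x} (\<lambda>w. gam a c w / w)) has_real_derivative gam a c s / s)
      (at s within {s/2..s+1})"
    using integral_has_real_derivative[OF cont] assms by simp
  then have "((\<lambda>x. integral {s/2..x} (\<lambda>w. gam a c w / w)) has_real_derivative gam a c s / s) (at s)"
    using assms by (simp add: at_within_Icc_at)
  then have d: "((\<lambda>x. Gam a c (s/2) + integral {s/2..x} (\<lambda>w. gam a c w / w))
      has_real_derivative gam a c s / s) (at s)"
    by (auto intro!: derivative_eq_intros)
  show ?thesis
  proof (rule DERIV_cong_ev[THEN iffD1, OF refl _ refl d])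
    have "eventually (\<lambda>x. x > s/2) (nhds s)"
      using assms eventually_nhds_in_open[of "{s/2<..}" s] by simp
    then show "\<forall>\<^sub>F x in nhds s. Gam a c (s/2) + integral {s/2..x} (\<lambda>w. gam a c w / w) = Gam a c x"
    proof eventually_elim
      case (elim x)
      then show ?case unfolding Gam_def
        using assms by (intro Henstock_Kurzweil_Integration.integral_combine integrable_gam_div) auto
    qed
  qed
qed

lemma Gam_pos:
  assumes "a > 0" "c > 0" "s > 0" shows "Gam a c s > 0"
proof -
  have "Gam a c 0 < Gam a c s"
  proof (rule DERIV_pos_imp_increasing_open[OF \<open>s > 0\<close>])
    show "continuous_on {0..s} (Gam a c)"
      using continuous_on_Gam[OF assms(1,2)] by (rule continuous_on_subset) auto
  qed (use Gam_deriv[OF assms(1,2)] gam_pos[of _ a c] in force)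
  then show ?thesis by simp
qed

section \<open>Bounds for \<open>gap\<close>, its Riccati equation, and comparison with a =
  1\<close>

lemma gap_pos:
  assumes "a > 0" "c > 0" "s > 0" shows "gap a c s > 0"
  using gam_pos[OF assms(3)] Gam_pos[OF assms] assms by (simp add: gap_def)

lemma gap_le:
  assumes "a > 0" "c > 0" "s > 0" shows "gap a c s \<le> c"
proof -
  have "0 \<le> integral {0..s} (gam a c)"
    by (rule integral_nonneg)
      (use assms in \<open>auto intro!: integrable_continuous_real continuous_on_subset[OF continuous_on_gam] gam_nonneg\<close>)
  then have "2 / a * gam a c s \<le> c * Gam a c s"
    using Gam_identity[of a c s] assms by simp
  then show ?thesis
    using Gam_pos[OF assms] assms by (simp add: gap_def field_simps)
qed

text \<open>The difference of the two sides vanishes at 0, and its derivative is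
  \<open>a / 2 * Gam a c s\<close>, the terms in \<open>gam\<close> cancelling. Dividing by
  \<open>Gam\<close> gives \<open>gap_gt\<close>.\<close>

lemma gam_gt:
  assumes "a > 0" "c > 0" "s > 0" shows "a / 2 * (c - s) * Gam a c s < gam a c s"
proof -
  define W where "W = (\<lambda>s. gam a c s - a / 2 * (c - s) * Gam a c s)"
  have "W 0 < W s"
  proof (rule DERIV_pos_imp_increasing_open[OF \<open>s > 0\<close>])
    show "continuous_on {0..s} W" unfolding W_def
      by (intro continuous_intros continuous_on_subset[OF continuous_on_Gam]
        continuous_on_subset[OF continuous_on_gam] assms) auto
    fix x assume x: "0 < x" "x < s"
    have "(W has_real_derivative a / 2 * Gam a c x) (at x)" unfolding W_def
      using x assms by (auto intro!: derivative_eq_intros gam_deriv Gam_deriv simp: divide_simps)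
    then show "\<exists>y. (W has_real_derivative y) (at x) \<and> 0 < y"
      using x assms Gam_pos[of a c x] by fastforce
  qed
  then show ?thesis by (simp add: W_def)
qed

lemma gap_gt:
  assumes "a > 0" "c > 0" "s > 0" shows "c - s < gap a c s"
  using gam_gt[OF assms] Gam_pos[OF assms] assms by (simp add: gap_def field_simps)

text \<open>The logarithmic derivative of \<open>Gam\<close> is
  \<open>a / 2 * gap a c s / s\<close>, which closes the equation in \<open>gap\<close>. By
  \<open>gap_pos\<close> and \<open>gap_gt\<close> the derivative is negative.\<close>

lemma gap_deriv:
  assumes "a > 0" "c > 0" "s > 0"
  shows "(gap a c has_real_derivative a / 2 * gap a c s * (c - s - gap a c s) / s) (at s)"
  unfolding gap_def using assms Gam_pos[OF assms] 
  by (auto intro!: derivative_eq_intros gam_deriv Gam_deriv simp: field_simps)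

text \<open>Cross-multiplied, and with \<open>gam 1 c s * gam (a - 1) c s = gam a c s\<close>, the
  claim becomes T > 0. T vanishes at 0, and its derivative is a positive multiple of the quantity
  that \<open>gam_gt\<close> shows to be positive for parameter 1.\<close>

lemma gap_less_gap_1:
  assumes "a > 1" "c > 0" "s > 0" shows "gap a c s < gap 1 c s"
proof -
  define T where "T = (\<lambda>s. a * Gam a c s - Gam 1 c s * gam (a - 1) c s)"
  have "T 0 < T s"
  proof (rule DERIV_pos_imp_increasing_open[OF \<open>s > 0\<close>])
    show "continuous_on {0..s} T" unfolding T_def
      by (intro continuous_intros continuous_on_subset[OF continuous_on_Gam]
        continuous_on_subset[OF continuous_on_gam]) (use assms in auto)
    fix x assume x: "0 < x" "x < s"
    have d: "(T has_real_derivative a * (gam a c x / x) - (gam 1 c x / x * gam (a - 1) c x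
       + Gam 1 c x * ((a - 1) / 2 * (c - x) * (gam (a - 1) c x / x)))) (at x)" unfolding T_def
      using x assms by (auto intro!: derivative_eq_intros gam_deriv Gam_deriv simp: divide_simps)
    have "a * (gam a c x / x) - (gam 1 c x / x * gam (a - 1) c x
       + Gam 1 c x * ((a - 1) / 2 * (c - x) * (gam (a - 1) c x / x)))
      = (a - 1) * gam (a - 1) c x / x * (gam 1 c x - 1 / 2 * (c - x) * Gam 1 c x)"
      using gam_mult[of 1 c x "a - 1"] x by (simp add: field_simps)
    moreover have "\<dots> > 0"
      using gam_gt[of 1 c x] gam_pos[of x "a - 1" c] x assms by simp
    ultimately show "\<exists>y. (T has_real_derivative y) (at x) \<and> 0 < y"
      using d by auto
  qed
  then have "Gam 1 c s * gam (a - 1) c s < a * Gam a c s"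
    by (simp add: T_def)
  then have "gam 1 c s * (Gam 1 c s * gam (a - 1) c s) < gam 1 c s * (a * Gam a c s)"
    using gam_pos[of s 1 c] assms by simp
  then have "Gam 1 c s * gam a c s < gam 1 c s * (a * Gam a c s)"
    using gam_mult[of 1 c s "a - 1"] assms by (simp add: mult_ac)
  then show ?thesis
    using Gam_pos[of a c s] Gam_pos[of 1 c s] assms by (simp add: gap_def field_simps)
qed

section \<open>Identification of \<open>phi\<close> in terms of \<open>gap\<close>\<close>

lemma set_lebesgue_integral_nonneg_has_integral:
  fixes f :: "real \<Rightarrow> real"
  assumes "(f has_integral I) S" "S \<in> sets borel" "\<And>x. x \<in> S \<Longrightarrow> f x \<ge> 0"
    "f \<in> borel_measurable borel"
  shows "(LINT x:S|lborel. f x) = I"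
proof -
  have "f absolutely_integrable_on S"
    using assms by (intro nonnegative_absolutely_integrable_1) auto
  then have "set_integrable lborel S f"
    unfolding set_integrable_def using assms
    by (subst integrable_completion[symmetric]) auto
  from set_borel_integral_eq_integral(2)[OF this] show ?thesis
    using assms(1) by (simp add: integral_unique)
qed

lemma has_integral_rescale_unit:
  fixes f :: "real \<Rightarrow> real"
  assumes "(f has_integral I) {0..s}" "s > 0"
  shows "((\<lambda>l. f (s * l)) has_integral I / s) {0..1}"
proof -
  have "((\<lambda>l. f (s *\<^sub>R l + 0)) has_integral (1 / \<bar>s\<bar> ^ DIM(real)) *\<^sub>R I)
     ((\<lambda>x. (1 / s) *\<^sub>R x + - ((1 / s) *\<^sub>R 0)) ` cbox 0 s)"
    by (rule has_integral_affinity) (use assms in auto)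
  moreover have "(\<lambda>x. x / s) ` {0..s} = {0..1}"
    using assms(2) by (auto simp: image_iff intro!: exI[of _ "s * _"] bexI[of _ "s * _"])
  ultimately show ?thesis
    using assms(2) by simp
qed

text \<open>The substitution w = s l turns the two integrals over the unit interval into those of
  \<open>gam\<close> and \<open>gam / w\<close> over \<open>{0..s}\<close>. Their quotient is
  evaluated by \<open>Gam_identity\<close>.\<close>

lemma phi_eq:
  assumes "a > 0" "p \<ge> 3" "s > 0"
  shows "phi p a s = (real p - 2) - gap a (real p - 2) s"
proof -
  define c where "c = real p - 2"
  have c: "c > 0" using assms by (simp add: c_def)
  define b where "b = a * (real p / 2 - 1)"
  have b: "b = a * c / 2" "b > 0" using c assms by (simp_all add: b_def c_def field_simps)
  define J where "J = integral {0..s} (gam a c)"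
  have "gam a c integrable_on {0..s}"
    by (intro integrable_continuous_real continuous_on_subset[OF continuous_on_gam] assms c) auto
  then have J: "(gam a c has_integral J) {0..s}"
    by (simp add: J_def integrable_integral)
  have G: "((\<lambda>w. gam a c w / w) has_integral Gam a c s) {0..s}"
    unfolding Gam_def using assms c by (intro integrable_integral integrable_gam_div) auto
  have "((\<lambda>l. gam a c (s * l)) has_integral J / s) {0..1}"
    by (rule has_integral_rescale_unit[OF J assms(3)])
  \<comment> \<open>The factor compensates the power of s that \<open>gam\<close> at s l contains;
    it cancels against its counterpart in the denominator.\<close>
  from has_integral_mult_right[OF this, of "s powr (- b)"]
  have num: "((\<lambda>l. l powr b * exp (- (s * a * l / 2))) has_integral s powr (- b) * (J / s)) {0..1}"
    by (rule has_integral_eq[rotated])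
      (use assms b in \<open>auto simp: gam_def b(1)[symmetric] powr_mult powr_minus field_simps\<close>)
  have "((\<lambda>l. gam a c (s * l) / (s * l)) has_integral Gam a c s / s) {0..1}"
    by (rule has_integral_rescale_unit[OF G assms(3)])
  from has_integral_mult_right[OF this, of "s powr (1 - b)"]
  have den: "((\<lambda>l. l powr (b - 1) * exp (- (s * a * l / 2))) has_integral
      s powr (1 - b) * (Gam a c s / s)) {0..1}"
    by (rule has_integral_eq[rotated])
      (use assms b in \<open>auto simp: gam_def b(1)[symmetric] powr_mult powr_diff field_simps\<close>)
  \<comment> \<open>\<open>phi\<close> is defined by Lebesgue integrals; nonnegativity of the
    integrands transfers the values of the gauge integrals.\<close>
  have "phi p a s = s * ((s powr (- b) * (J / s)) / (s powr (1 - b) * (Gam a c s / s)))"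
    unfolding phi_def b_def[symmetric]
    using set_lebesgue_integral_nonneg_has_integral[OF num]
      set_lebesgue_integral_nonneg_has_integral[OF den] by simp
  also have "\<dots> = J / Gam a c s"
    using assms Gam_pos[OF assms(1) c assms(3)] by (simp add: powr_diff powr_minus field_simps)
  also have "\<dots> = c - gap a c s"
    using Gam_identity[OF assms(1) c, of s] Gam_pos[OF assms(1) c assms(3)] assms
    by (simp add: J_def[symmetric] gap_def field_simps)
  finally show ?thesis by (simp add: c_def)
qed

section \<open>The limit of \<open>gap\<close> for large a, from an integral for its
  reciprocal\<close>

lemma gap_eq_inverse_integral:
  assumes "a > 0" "c > 0" "s > 0"
  shows "((\<lambda>l. l powr (a * c / 2) / l * exp (a * s / 2 * (1 - l))) has_integral
          2 / (a * gap a c s)) {0..1}"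
proof -
  have "((\<lambda>w. gam a c w / w) has_integral Gam a c s) {0..s}"
    unfolding Gam_def using assms by (intro integrable_integral integrable_gam_div) auto
  from has_integral_rescale_unit[OF this assms(3)]
  have "((\<lambda>l. gam a c (s * l) / (s * l)) has_integral Gam a c s / s) {0..1}" .
  from has_integral_mult_right[OF this, of "s / gam a c s"]
  have "((\<lambda>l. l powr (a * c / 2) / l * exp (a * s / 2 * (1 - l))) has_integral
      s / gam a c s * (Gam a c s / s)) {0..1}"
  proof (rule has_integral_eq[rotated])
    fix l :: real assume "l \<in> {0..1}"
    have "exp (a * s / 2 * (1 - l)) = exp (- (a * (s * l) / 2)) / exp (- (a * s / 2))"
      unfolding exp_diff[symmetric] by (simp add: algebra_simps diff_divide_distrib)
    then show "s / gam a c s * (gam a c (s * l) / (s * l)) = l powr (a * c / 2) / l * exp (a * s / 2 * (1 - l))"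
      using assms \<open>l \<in> {0..1}\<close> by (simp add: gam_def powr_mult)
  qed
  moreover have "s / gam a c s * (Gam a c s / s) = 2 / (a * gap a c s)"
    using assms Gam_pos[OF assms] gam_pos[of s a c] by (simp add: gap_def)
  ultimately show ?thesis by simp
qed

text \<open>Laplace's method: since \<open>ln l \<ge> - (1 - l) / l\<close>, on \<open>{\<eta>..1}\<close> the integrand of
  \<open>2 / (a * gap a c s)\<close> is at least \<open>exp (- (a * m / 2) * (1 - l))\<close> with \<open>m = c / \<eta> - s\<close>.\<close>

lemma gap_upper_bound:
  assumes "a > 0" "c > 0" "s > 0" "0 < \<eta>" "\<eta> < 1" "m = c / \<eta> - s" "m > 0"
  shows "gap a c s * (1 - exp (- (a * m / 2) * (1 - \<eta>))) \<le> m"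
proof -
  have "((\<lambda>l. exp (- (a * m / 2) * (1 - l))) has_integral
      2 / (a * m) * exp (- (a * m / 2) * (1 - 1)) - 2 / (a * m) * exp (- (a * m / 2) * (1 - \<eta>))) {\<eta>..1}"
    using assms by (intro fundamental_theorem_of_calculus)
      (auto simp flip: has_real_derivative_iff_has_vector_derivative intro!: derivative_eq_intros)
  then have "((\<lambda>l. exp (- (a * m / 2) * (1 - l))) has_integral
      2 / (a * m) * (1 - exp (- (a * m / 2) * (1 - \<eta>)))) {\<eta>..1}"
    by (simp add: algebra_simps)
  \<comment> \<open>Extended by 0 below \<open>\<eta>\<close>, the bound can be compared on all of
    \<open>{0..1}\<close>, where the integrand is nonnegative.\<close>
  then have int: "((\<lambda>l. if l \<in> {\<eta>..1} then exp (- (a * m / 2) * (1 - l)) else 0) has_integral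
      2 / (a * m) * (1 - exp (- (a * m / 2) * (1 - \<eta>)))) {0..1}"
    using assms by (subst has_integral_restrict) auto
  have "2 / (a * m) * (1 - exp (- (a * m / 2) * (1 - \<eta>))) \<le> 2 / (a * gap a c s)"
  proof (rule has_integral_le[OF int gap_eq_inverse_integral[OF assms(1-3)]], goal_cases)
    case (1 l)
    show ?case
    proof (cases "l \<in> {\<eta>..1}")
    case l: True
    then have l0: "l > 0" using assms by auto
    have "(1 - l) / l \<le> (1 - l) / \<eta>"
      using l assms by (intro divide_left_mono) auto
    then have "- (1 - l) / \<eta> \<le> - (1 - l) / l"
      unfolding minus_divide_left[symmetric] by (rule le_imp_neg_le)
    also have "\<dots> = 1 - 1 / l" using l0 by (simp add: field_simps)
    also have "\<dots> \<le> ln l"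
      using ln_le_minus_one[of "1 / l"] l0 by (simp add: ln_div)
    finally have "a * c / 2 * (- (1 - l) / \<eta>) \<le> a * c / 2 * ln l"
      using assms by (intro mult_left_mono) auto
    moreover have "- (a * m / 2) * (1 - l) = a * c / 2 * (- (1 - l) / \<eta>) + a * s / 2 * (1 - l)"
      unfolding assms(6) using assms(4) by (simp add: field_simps)
    ultimately have "- (a * m / 2) * (1 - l) \<le> a * c / 2 * ln l + a * s / 2 * (1 - l)"
      by linarith
    then have "exp (- (a * m / 2) * (1 - l)) \<le> exp (a * c / 2 * ln l + a * s / 2 * (1 - l))"
      by simp
    also have "\<dots> = l powr (a * c / 2) * exp (a * s / 2 * (1 - l))"
      using l0 by (simp add: powr_def exp_add)
    also have "\<dots> \<le> l powr (a * c / 2) / l * exp (a * s / 2 * (1 - l))"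
      using l l0 by (intro mult_right_mono) (auto simp: field_simps mult_left_le)
    finally show ?thesis using l by simp
    qed (use 1 in simp)
  qed
  then have "E / m \<le> 1 / gap a c s" if "E = 1 - exp (- (a * m / 2) * (1 - \<eta>))" for E
    using assms(1) mult_left_mono[of "2 / (a * m) * E" "2 / (a * gap a c s)" "a / 2"]
    unfolding that[symmetric] by simp
  then show ?thesis
    using assms(7) gap_pos[OF assms(1-3)] by (simp add: pos_divide_le_eq pos_le_divide_eq mult_ac)
qed

text \<open>The lower bounds \<open>gap_gt\<close> and \<open>gap_pos\<close> hold for every
  positive a. The upper bound is \<open>gap_upper_bound\<close> for an m strictly between the limit
  and y: the exponential there tends to 0, which leaves room to pass from m to y.\<close>

lemma gap_tendsto:
  assumes "c > 0" "s > 0"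
  shows "((\<lambda>a. gap a c s) \<longlongrightarrow> max 0 (c - s)) at_top"
proof (rule order_tendstoI)
  fix y assume "y < max 0 (c - s)"
  with gap_gt[OF _ assms] gap_pos[OF _ assms] have "y < gap a c s" if "a > 0" for a
    using that by (smt (verit))
  then show "\<forall>\<^sub>F a in at_top. y < gap a c s"
    by (intro eventually_mono[OF eventually_gt_at_top[of 0]])
next
  fix y assume y: "max 0 (c - s) < y"
  define m where "m = (max 0 (c - s) + y) / 2"
  have m: "max 0 (c - s) < m" "m < y" "m > 0" using y by (auto simp: m_def)
  \<comment> \<open>Solves \<open>m = c / \<eta> - s\<close>; it is below 1 because m > c -
    s.\<close>
  define \<eta> where "\<eta> = c / (s + m)"
  have \<eta>: "0 < \<eta>" "\<eta> < 1" "m = c / \<eta> - s"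
    using m assms by (auto simp: \<eta>_def field_simps)
  have "((\<lambda>a. 1 - exp (- (a * m / 2) * (1 - \<eta>))) \<longlongrightarrow> 1 - 0) at_top"
  proof (intro tendsto_diff tendsto_const filterlim_compose[OF exp_at_bot])
    have "LIM a at_top. - (m / 2 * (1 - \<eta>)) * a :> at_bot"
      using m \<eta> by (intro filterlim_tendsto_neg_mult_at_bot[OF tendsto_const] filterlim_ident) auto
    then show "LIM a at_top. - (a * m / 2) * (1 - \<eta>) :> at_bot"
      by (simp add: mult_ac)
  qed
  then have "((\<lambda>a. y * (1 - exp (- (a * m / 2) * (1 - \<eta>)))) \<longlongrightarrow> y * 1) at_top"
    by (intro tendsto_mult tendsto_const) simp
  then have "\<forall>\<^sub>F a in at_top. m < y * (1 - exp (- (a * m / 2) * (1 - \<eta>)))"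
    using m by (intro order_tendstoD) auto
  then show "\<forall>\<^sub>F a in at_top. gap a c s < y"
    using eventually_gt_at_top[of 0]
  proof eventually_elim
    case (elim a)
    from gap_upper_bound[OF elim(2) assms \<eta> m(3)] elim(1)
    have "gap a c s * (1 - exp (- (a * m / 2) * (1 - \<eta>))) < y * (1 - exp (- (a * m / 2) * (1 - \<eta>)))"
      by linarith
    moreover have "1 - exp (- (a * m / 2) * (1 - \<eta>)) > 0"
      using elim m \<eta> by simp
    ultimately show ?case
      by (simp only: mult_less_cancel_right_pos)
  qed
qed

section \<open>Polar integration\<close>

lemma nn_integral_scaleR:
  fixes f :: "'a::euclidean_space \<Rightarrow> ennreal"
  assumes [measurable]: "f \<in> borel_measurable borel" and "t > 0"
  shows "(\<integral>\<^sup>+x. f x \<partial>lborel) = ennreal (t ^ DIM('a)) * (\<integral>\<^sup>+x. f (t *\<^sub>R x) \<partial>lborel)"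
  using assms
  by (subst lborel_affine[of t 0])
    (simp_all add: nn_integral_density nn_integral_distr nn_integral_cmult)

lemma nn_integral_inverse_Icc:
  assumes "r > 0"
  shows "(\<integral>\<^sup>+t. ennreal (1 / t) * indicator {r / exp 1..r} t \<partial>lborel) = 1"
proof -
  have "(\<integral>\<^sup>+t. ennreal (1 / t) * indicator {r / exp 1..r} t \<partial>lborel) = ennreal (ln r - ln (r / exp 1))"
  proof (rule nn_integral_FTC_Icc)
    fix t assume "t \<in> {r / exp 1..r}"
    then have "t > 0" using assms by (auto intro: less_le_trans[of 0 "r / exp 1"])
    then show "DERIV ln t :> 1 / t" "0 \<le> 1 / t"
      by (auto intro!: derivative_eq_intros)
  qed (use assms in \<open>auto simp: field_simps\<close>)
  also have "ln r - ln (r / exp 1) = 1" using assms by (simp add: ln_div)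
  finally show ?thesis by simp
qed

text \<open>Polar coordinates without the surface measure: the shell \<open>1 \<le> norm y \<le> exp 1\<close> serves as the
  space of directions, because every ray meets it in a segment of logarithmic length 1.\<close>

lemma nn_integral_polar:
  fixes f :: "'a::euclidean_space \<Rightarrow> ennreal"
  assumes [measurable]: "f \<in> borel_measurable borel"
  shows "(\<integral>\<^sup>+x. f x \<partial>lborel) =
    (\<integral>\<^sup>+y. indicator {y. 1 \<le> norm y \<and> norm y \<le> exp 1} y *
       (\<integral>\<^sup>+t. f (t *\<^sub>R y) * ennreal (t ^ (DIM('a) - 1)) * indicator {0<..} t \<partial>lborel) \<partial>lborel)"
proof -
  define S :: "'a set" where "S = {y. 1 \<le> norm y \<and> norm y \<le> exp 1}"
  have [measurable]: "S \<in> sets borel" unfolding S_def by measurable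
  have "(\<integral>\<^sup>+y. indicator S y * (\<integral>\<^sup>+t. f (t *\<^sub>R y) * ennreal (t ^ (DIM('a) - 1)) * indicator {0<..} t \<partial>lborel) \<partial>lborel)
      = (\<integral>\<^sup>+y. \<integral>\<^sup>+t. indicator S y * (f (t *\<^sub>R y) * ennreal (t ^ (DIM('a) - 1)) * indicator {0<..} t) \<partial>lborel \<partial>lborel)"
    by (simp add: nn_integral_cmult)
  also have "\<dots> = (\<integral>\<^sup>+t. \<integral>\<^sup>+y. indicator S y * (f (t *\<^sub>R y) * ennreal (t ^ (DIM('a) - 1)) * indicator {0<..} t) \<partial>lborel \<partial>lborel)"
    by (rule lborel_pair.Fubini') simp
  \<comment> \<open>Substitute \<open>x = t *\<^sub>R y\<close> for fixed t: the Jacobian reduces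
    the power of t to 1 / t, and y lies in the shell iff t lies in
    \<open>{norm x / exp 1..norm x}\<close>.\<close>
  also have "\<dots> = (\<integral>\<^sup>+t. \<integral>\<^sup>+x. f x * (ennreal (1 / t) * indicator {norm x / exp 1..norm x} t * indicator {0<..} t) \<partial>lborel \<partial>lborel)"
  proof (rule nn_integral_cong)
    fix t :: real
    show "(\<integral>\<^sup>+y. indicator S y * (f (t *\<^sub>R y) * ennreal (t ^ (DIM('a) - 1)) * indicator {0<..} t) \<partial>lborel)
      = (\<integral>\<^sup>+x. f x * (ennreal (1 / t) * indicator {norm x / exp 1..norm x} t * indicator {0<..} t) \<partial>lborel)"
    proof (cases "t > 0")
      case t: True
      have "(\<integral>\<^sup>+x. f x * (ennreal (1 / t) * indicator {norm x / exp 1..norm x} t * indicator {0<..} t) \<partial>lborel)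
        = (\<integral>\<^sup>+x. f x * (ennreal (1 / t) * indicator S ((1 / t) *\<^sub>R x)) \<partial>lborel)"
        using t by (intro nn_integral_cong) (auto simp: S_def indicator_def field_simps)
      also have "\<dots> = ennreal (t ^ DIM('a)) * (\<integral>\<^sup>+x. f (t *\<^sub>R x) * (ennreal (1 / t) * indicator S x) \<partial>lborel)"
        using t by (subst nn_integral_scaleR[OF _ t]) simp_all
      also have "\<dots> = ennreal (t ^ DIM('a)) * (\<integral>\<^sup>+x. ennreal (1 / t) * (f (t *\<^sub>R x) * indicator S x) \<partial>lborel)"
        by (simp only: mult_ac)
      also have "\<dots> = (ennreal (t ^ DIM('a)) * ennreal (1 / t)) * (\<integral>\<^sup>+x. f (t *\<^sub>R x) * indicator S x \<partial>lborel)"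
        by (subst nn_integral_cmult) (simp_all add: mult.assoc)
      also have "ennreal (t ^ DIM('a)) * ennreal (1 / t) = ennreal (t ^ (DIM('a) - 1))"
        using t DIM_positive[where 'a='a]
        by (simp add: ennreal_mult[symmetric] power_minus_mult[symmetric, of "DIM('a)"])
      also have "ennreal (t ^ (DIM('a) - 1)) * (\<integral>\<^sup>+x. f (t *\<^sub>R x) * indicator S x \<partial>lborel)
        = (\<integral>\<^sup>+x. ennreal (t ^ (DIM('a) - 1)) * (f (t *\<^sub>R x) * indicator S x) \<partial>lborel)"
        by (rule nn_integral_cmult[symmetric]) simp
      finally show ?thesis using t by (simp add: mult_ac)
    qed simp
  qed
  also have "\<dots> = (\<integral>\<^sup>+x. \<integral>\<^sup>+t. f x * (ennreal (1 / t) * indicator {norm x / exp 1..norm x} t * indicator {0<..} t) \<partial>lborel \<partial>lborel)"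
    by (rule lborel_pair.Fubini') (simp add: indicator_def cong: if_cong)
  also have "\<dots> = (\<integral>\<^sup>+x. f x \<partial>lborel)"
  proof (rule nn_integral_cong_AE)
    have "(\<integral>\<^sup>+t. f x * (ennreal (1 / t) * indicator {norm x / exp 1..norm x} t * indicator {0<..} t) \<partial>lborel) = f x"
      if "x \<noteq> 0" for x
    proof -
      have "(\<integral>\<^sup>+t. f x * (ennreal (1 / t) * indicator {norm x / exp 1..norm x} t * indicator {0<..} t) \<partial>lborel)
        = f x * (\<integral>\<^sup>+t. ennreal (1 / t) * indicator {norm x / exp 1..norm x} t * indicator {0<..} t \<partial>lborel)"
        by (rule nn_integral_cmult) simp
      also have "(\<integral>\<^sup>+t. ennreal (1 / t) * indicator {norm x / exp 1..norm x} t * indicator {0<..} t \<partial>lborel)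
        = (\<integral>\<^sup>+t. ennreal (1 / t) * indicator {norm x / exp 1..norm x} t \<partial>lborel)"
      proof (rule nn_integral_cong)
        fix t
        have "norm x / exp 1 > 0" using that by simp
        then show "ennreal (1 / t) * indicator {norm x / exp 1..norm x} t * indicator {0<..} t
          = ennreal (1 / t) * indicator {norm x / exp 1..norm x} t"
          by (cases "t > 0") (simp_all add: indicator_def)
      qed
      finally show ?thesis using that nn_integral_inverse_Icc[of "norm x"] by simp
    qed
    then show "AE x in lborel. (\<integral>\<^sup>+t. f x * (ennreal (1 / t) * indicator {norm x / exp 1..norm x} t * indicator {0<..} t) \<partial>lborel) = f x"
      using AE_lborel_singleton[of "0::'a"] by auto
  qed
  finally show ?thesis by (simp add: S_def)
qed

section \<open>Comparison of integrals line by line\<close>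

lemma nn_integral_uminus:
  fixes f :: "'a::euclidean_space \<Rightarrow> ennreal"
  assumes [measurable]: "f \<in> borel_measurable borel"
  shows "(\<integral>\<^sup>+x. f (- x) \<partial>lborel) = (\<integral>\<^sup>+x. f x \<partial>lborel)"
  by (subst (2) lborel_affine[of "-1" 0])
    (simp_all add: nn_integral_density nn_integral_distr)

text \<open>Apply \<open>nn_integral_polar\<close> to h x + h (- x), whose integral is twice that of
  h. The shell contains vectors longer than 1, but rescaling r changes the line integral only by the
  factor \<open>norm y ^ DIM('a)\<close>, which is positive and finite and cancels.\<close>

lemma nn_integral_eq_on_lines:
  fixes f g :: "'a::euclidean_space \<Rightarrow> ennreal"
  assumes [measurable]: "f \<in> borel_measurable borel" "g \<in> borel_measurable borel"
    and eq: "\<And>u. norm u = 1 \<Longrightarrow>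
      (\<integral>\<^sup>+r. (f (r *\<^sub>R u) + f (- (r *\<^sub>R u))) * ennreal (r ^ (DIM('a) - 1)) * indicator {0<..} r \<partial>lborel) =
      (\<integral>\<^sup>+r. (g (r *\<^sub>R u) + g (- (r *\<^sub>R u))) * ennreal (r ^ (DIM('a) - 1)) * indicator {0<..} r \<partial>lborel)"
  shows "(\<integral>\<^sup>+x. f x \<partial>lborel) = (\<integral>\<^sup>+x. g x \<partial>lborel)"
proof -
  define I where "I = (\<lambda>h (u :: 'a). (\<integral>\<^sup>+r. (h (r *\<^sub>R u) + h (- (r *\<^sub>R u)) :: ennreal) *
      ennreal (r ^ (DIM('a) - 1)) * indicator {0<..} r \<partial>lborel))"
  have scale: "I h ((1 / norm y) *\<^sub>R y) = ennreal (norm y ^ DIM('a)) * I h y"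
    if [measurable]: "h \<in> borel_measurable borel" and "1 \<le> norm y" for h y
  proof -
    have n: "norm y > 0" using that by linarith
    have "I h ((1 / norm y) *\<^sub>R y) = ennreal \<bar>norm y\<bar> * (\<integral>\<^sup>+t. (h ((0 + norm y * t) *\<^sub>R (1 / norm y) *\<^sub>R y) + h (- ((0 + norm y * t) *\<^sub>R (1 / norm y) *\<^sub>R y))) *
      ennreal ((0 + norm y * t) ^ (DIM('a) - 1)) * indicator {0<..} (0 + norm y * t) \<partial>lborel)"
      unfolding I_def using n by (intro nn_integral_real_affine) auto
    also have "\<dots> = ennreal (norm y) * (\<integral>\<^sup>+t. ennreal (norm y ^ (DIM('a) - 1)) * ((h (t *\<^sub>R y) + h (- (t *\<^sub>R y))) *
      ennreal (t ^ (DIM('a) - 1)) * indicator {0<..} t) \<partial>lborel)"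
    proof -
      have "(h ((0 + norm y * t) *\<^sub>R (1 / norm y) *\<^sub>R y) + h (- ((0 + norm y * t) *\<^sub>R (1 / norm y) *\<^sub>R y))) *
          ennreal ((0 + norm y * t) ^ (DIM('a) - 1)) * indicator {0<..} (0 + norm y * t) =
        ennreal (norm y ^ (DIM('a) - 1)) * ((h (t *\<^sub>R y) + h (- (t *\<^sub>R y))) *
          ennreal (t ^ (DIM('a) - 1)) * indicator {0<..} t)" for t
      proof (cases "t > 0")
        case True
        then have "ennreal ((norm y * t) ^ (DIM('a) - 1)) =
            ennreal (norm y ^ (DIM('a) - 1)) * ennreal (t ^ (DIM('a) - 1))"
          by (simp add: power_mult_distrib ennreal_mult)
        moreover have "(norm y * t) *\<^sub>R (1 / norm y) *\<^sub>R y = t *\<^sub>R y"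
          using n by simp
        ultimately show ?thesis
          using True n by (simp only: add_0_left) (simp add: mult_ac)
      qed (use n in \<open>simp add: zero_less_mult_iff\<close>)
      then show ?thesis by (simp only: abs_norm_cancel)
    qed
    also have "\<dots> = ennreal (norm y) * (ennreal (norm y ^ (DIM('a) - 1)) * I h y)"
      unfolding I_def by (subst nn_integral_cmult) auto
    also have "\<dots> = ennreal (norm y ^ DIM('a)) * I h y"
      using n DIM_positive[where 'a='a]
      by (simp add: power_minus_mult[symmetric, of "DIM('a)"] ennreal_mult mult_ac)
    finally show ?thesis .
  qed
  have eqI: "I f y = I g y" if "1 \<le> norm y" for y
  proof -
    have n: "norm y > 0" using that by linarith
    have "I f ((1 / norm y) *\<^sub>R y) = I g ((1 / norm y) *\<^sub>R y)"
      using eq[of "(1 / norm y) *\<^sub>R y"] n unfolding I_def by simp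
    then show ?thesis
      using that n by (simp add: scale ennreal_mult_cancel_left)
  qed
  have double: "(\<integral>\<^sup>+y. indicator {y. 1 \<le> norm y \<and> norm y \<le> exp 1} y * I h y \<partial>lborel) = 2 * (\<integral>\<^sup>+x. h x \<partial>lborel)"
    if [measurable]: "h \<in> borel_measurable borel" for h
  proof -
    have "2 * (\<integral>\<^sup>+x. h x \<partial>lborel) = (\<integral>\<^sup>+x. h x + h (- x) \<partial>lborel)"
      by (simp add: nn_integral_add nn_integral_uminus mult_2)
    also have "\<dots> = (\<integral>\<^sup>+y. indicator {y. 1 \<le> norm y \<and> norm y \<le> exp 1} y * I h y \<partial>lborel)"
      unfolding I_def by (rule nn_integral_polar) simp
    finally show ?thesis ..
  qed
  have "2 * (\<integral>\<^sup>+x. f x \<partial>lborel) = 2 * (\<integral>\<^sup>+x. g x \<partial>lborel)"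
    unfolding double[OF assms(1), symmetric] double[OF assms(2), symmetric]
    by (intro nn_integral_cong) (auto simp: indicator_def eqI)
  then show ?thesis by (simp add: ennreal_mult_cancel_left)
qed

text \<open>On compact intervals exhausting the half-line the two integrals differ by an increment
  of V, which tends to 0. Monotone convergence in [0, \<infinity>] then carries the equality to the
  half-line.\<close>

lemma nn_integral_Ioi_eq_of_antiderivative:
  fixes f g V :: "real \<Rightarrow> real"
  assumes cont: "continuous_on {0<..} f" "continuous_on {0<..} g"
    and nonneg: "\<And>r. r > 0 \<Longrightarrow> f r \<ge> 0" "\<And>r. r > 0 \<Longrightarrow> g r \<ge> 0"
    and deriv: "\<And>r. r > 0 \<Longrightarrow> (V has_real_derivative g r - f r) (at r)"
    and lim: "(V \<longlongrightarrow> 0) (at_right 0)" "(V \<longlongrightarrow> 0) at_top"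
  shows "(\<integral>\<^sup>+r. ennreal (f r) * indicator {0<..} r \<partial>lborel) = (\<integral>\<^sup>+r. ennreal (g r) * indicator {0<..} r \<partial>lborel)"
proof -
  \<comment> \<open>\<open>Suc n\<close> avoids 1/0 and makes the interval nonempty already for n =
    0.\<close>
  define A where "A = (\<lambda>n. {1 / real (Suc n)..real (Suc n)})"
  have Asub: "A n \<subseteq> {0<..}" for n
    by (auto simp: A_def intro: less_le_trans[rotated])
  have Aincr: "A m \<subseteq> A n" if "m \<le> n" for m n
    using that by (auto simp: A_def frac_le intro: order_trans[rotated])
  have inA: "\<exists>n. r \<in> A n" if "r > 0" for r
  proof -
    obtain n where n: "max r (1 / r) < real n" using reals_Archimedean2 by blast
    then have "r \<in> A n" using that by (auto simp: A_def field_simps)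
    then show ?thesis ..
  qed
  have ind: "(SUP n. indicator (A n) r) = (indicator {0<..} r :: ennreal)" for r
  proof (rule antisym)
    show "(SUP n. indicator (A n) r) \<le> (indicator {0<..} r :: ennreal)"
      using Asub by (intro SUP_least) (auto simp: indicator_def)
    show "(indicator {0<..} r :: ennreal) \<le> (SUP n. indicator (A n) r)"
    proof (cases "r > 0")
      case True
      then obtain n where "r \<in> A n" using inA by blast
      then show ?thesis using True by (intro SUP_upper2[of n]) auto
    qed simp
  qed
  have meas: "(\<lambda>r. ennreal (h r) * indicator (A n) r) \<in> borel_measurable borel"
    if "continuous_on {0<..} h" for h n
  proof -
    have "(\<lambda>r. indicator (A n) r *\<^sub>R h r) \<in> borel_measurable borel"
      using that Asub[of n] by (intro borel_measurable_continuous_on_indicator continuous_on_subset[OF that])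
        (auto simp: A_def)
    then have "(\<lambda>r. ennreal (indicator (A n) r *\<^sub>R h r)) \<in> borel_measurable borel" by simp
    also have "(\<lambda>r. ennreal (indicator (A n) r *\<^sub>R h r)) = (\<lambda>r. ennreal (h r) * indicator (A n) r)"
      by (auto simp: indicator_def)
    finally show ?thesis .
  qed
  have lims: "(\<lambda>n. \<integral>\<^sup>+r. ennreal (h r) * indicator (A n) r \<partial>lborel) \<longlonglongrightarrow>
      (\<integral>\<^sup>+r. ennreal (h r) * indicator {0<..} r \<partial>lborel)" if "continuous_on {0<..} h" for h
  proof -
    have inc: "incseq (\<lambda>n r. ennreal (h r) * indicator (A n) r)"
      using Aincr by (intro incseq_SucI le_funI mult_left_mono)
        (auto simp: indicator_def dest: subsetD[OF Aincr[OF le_SucI[OF order_refl]]])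
    have "(\<integral>\<^sup>+r. ennreal (h r) * indicator {0<..} r \<partial>lborel) = (\<integral>\<^sup>+r. (SUP n. ennreal (h r) * indicator (A n) r) \<partial>lborel)"
      by (simp add: SUP_mult_left_ennreal[symmetric] ind)
    also have "\<dots> = (SUP n. \<integral>\<^sup>+r. ennreal (h r) * indicator (A n) r \<partial>lborel)"
      using inc meas[OF that] by (intro nn_integral_monotone_convergence_SUP) auto
    finally show ?thesis
      using inc by (auto intro!: LIMSEQ_SUP incseq_SucI nn_integral_mono simp: incseq_def le_fun_def)
  qed
  define F where "F = (\<lambda>h n. integral (A n) (h :: real \<Rightarrow> real))"
  have fin: "(\<integral>\<^sup>+r. ennreal (h r) * indicator (A n) r \<partial>lborel) = ennreal (F h n)"
    "(h has_integral F h n) (A n)" "F h n \<ge> 0"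
    if "continuous_on {0<..} h" "\<And>r. r > 0 \<Longrightarrow> h r \<ge> 0" for h n
  proof -
    have "h integrable_on A n"
      unfolding A_def using Asub[of n] 
      by (intro integrable_continuous_real continuous_on_subset[OF that(1)]) (auto simp: A_def)
    then show i: "(h has_integral F h n) (A n)" by (simp add: F_def integrable_integral)
    have nn: "h r \<ge> 0" if "r \<in> A n" for r
      using that Asub[of n] \<open>\<And>r. r > 0 \<Longrightarrow> h r \<ge> 0\<close> by auto
    show "(\<integral>\<^sup>+r. ennreal (h r) * indicator (A n) r \<partial>lborel) = ennreal (F h n)"
      by (rule nn_integral_has_integral_lebesgue'[OF nn i])
    show "F h n \<ge> 0" using i nn by (rule has_integral_nonneg)
  qed
  have diff: "F g n - F f n = V (real (Suc n)) - V (1 / real (Suc n))" for n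
  proof -
    have "((\<lambda>r. g r - f r) has_integral V (real (Suc n)) - V (1 / real (Suc n))) (A n)"
      unfolding A_def
    proof (rule fundamental_theorem_of_calculus)
      have "1 / real (Suc n) \<le> 1" by simp
      also have "1 \<le> real (Suc n)" by simp
      finally show "1 / real (Suc n) \<le> real (Suc n)" .
      fix x assume "x \<in> {1 / real (Suc n)..real (Suc n)}"
      then have "x > 0" using Asub[of n] by (auto simp: A_def)
      then show "(V has_vector_derivative g x - f x) (at x within {1 / real (Suc n)..real (Suc n)})"
        using deriv by (auto simp flip: has_real_derivative_iff_has_vector_derivative intro: DERIV_subset)
    qed
    moreover have "((\<lambda>r. g r - f r) has_integral F g n - F f n) (A n)"
      using cont nonneg by (intro has_integral_diff fin)
    ultimately show ?thesis by (rule has_integral_unique[rotated])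
  qed
  have V1: "(\<lambda>n. V (real (Suc n))) \<longlonglongrightarrow> 0"
    by (rule filterlim_compose[OF lim(2) filterlim_compose[OF filterlim_real_sequentially filterlim_Suc]])
  have V2: "(\<lambda>n. V (1 / real (Suc n))) \<longlonglongrightarrow> 0"
  proof (rule filterlim_compose[OF lim(1)])
    show "LIM n sequentially. 1 / real (Suc n) :> at_right 0"
      unfolding filterlim_at using LIMSEQ_inverse_real_of_nat by (auto simp: inverse_eq_divide)
  qed
  \<comment> \<open>The absolute value serves as an additive error in both inequalities, so nothing
    is subtracted in \<open>ennreal\<close>.\<close>
  define D where "D = (\<lambda>n. \<bar>V (real (Suc n)) - V (1 / real (Suc n))\<bar>)"
  have D: "(\<lambda>n. ennreal (D n)) \<longlonglongrightarrow> 0"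
    using tendsto_ennrealI[OF tendsto_rabs_zero[OF tendsto_diff[OF V1 V2, simplified]]]
    by (simp add: D_def)
  have le: "(\<integral>\<^sup>+r. ennreal (h r) * indicator {0<..} r \<partial>lborel) \<le> (\<integral>\<^sup>+r. ennreal (k r) * indicator {0<..} r \<partial>lborel)"
    if h: "continuous_on {0<..} h" "\<And>r. r > 0 \<Longrightarrow> h r \<ge> 0"
      and k: "continuous_on {0<..} k" "\<And>r. r > 0 \<Longrightarrow> k r \<ge> 0"
      and d: "\<And>n. F h n \<le> F k n + D n" for h k
  proof (rule LIMSEQ_le[OF lims[OF h(1)]])
    show "(\<lambda>n. (\<integral>\<^sup>+r. ennreal (k r) * indicator (A n) r \<partial>lborel) + ennreal (D n)) \<longlonglongrightarrow>
      (\<integral>\<^sup>+r. ennreal (k r) * indicator {0<..} r \<partial>lborel)"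
      using tendsto_add[OF lims[OF k(1)] D] by simp
    show "\<exists>N. \<forall>n\<ge>N. (\<integral>\<^sup>+r. ennreal (h r) * indicator (A n) r \<partial>lborel) \<le>
        (\<integral>\<^sup>+r. ennreal (k r) * indicator (A n) r \<partial>lborel) + ennreal (D n)"
      using d fin[OF h] fin[OF k]
      by (auto simp: D_def ennreal_plus[symmetric] simp del: ennreal_plus intro!: ennreal_leI)
  qed
  show ?thesis
  proof (intro antisym le cont nonneg)
    fix n
    show "F f n \<le> F g n + D n" "F g n \<le> F f n + D n"
      using diff[of n] unfolding D_def by linarith+
  qed
qed

section \<open>The loss along a line\<close>

text \<open>For a unit vector \<open>u\<close> with \<open>b = \<theta> \<bullet> u\<close> and \<open>t = (norm \<theta>)\<^sup>2\<close>, \<open>line_loss\<close> is up to a constant factor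
  the sum of loss times Gaussian density at \<open>r *\<^sub>R u\<close> and \<open>- r *\<^sub>R u\<close>, weighted by the polar factor
  \<open>r ^ (p - 1)\<close>, for an estimator taking the values \<open>d *\<^sub>R u\<close> and \<open>- d *\<^sub>R u\<close> there.\<close>

definition line_loss :: "real \<Rightarrow> real \<Rightarrow> real \<Rightarrow> real \<Rightarrow> real \<Rightarrow> real" where
  "line_loss c b t d r =
     ((d\<^sup>2 - 2 * d * b + t) * exp (b * r) + (d\<^sup>2 + 2 * d * b + t) * exp (- (b * r))) / 2 * (r * gam 1 c (r\<^sup>2))"

text \<open>This is the remainder in the derivative of \<open>line_pot\<close>. The factor with
  \<open>/ r\<close> is minus the derivative of \<open>gap a c (r\<^sup>2)\<close> in r; the last
  factor is nonnegative by \<open>gap_Gam_le\<close> and vanishes for a = 1.\<close>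

definition line_gain :: "real \<Rightarrow> real \<Rightarrow> real \<Rightarrow> real \<Rightarrow> real" where
  "line_gain a c b r =
     b * sinh (b * r) * (gap a c (r\<^sup>2))\<^sup>2 * (Gam 1 c (r\<^sup>2) / 2)
     + 2 * cosh (b * r) * (a * gap a c (r\<^sup>2) * (gap a c (r\<^sup>2) - (c - r\<^sup>2)) / r)
         * (gam 1 c (r\<^sup>2) - gap a c (r\<^sup>2) * (Gam 1 c (r\<^sup>2) / 2))"

section \<open>Signs of the remainder and of the loss\<close>

lemma gap_le_gap_1:
  assumes "a \<ge> 1" "c > 0" "s > 0" shows "gap a c s \<le> gap 1 c s"
  using gap_less_gap_1[of a c s] assms by (cases "a = 1") auto

lemma gap_Gam_le:
  assumes "a \<ge> 1" "c > 0" "s > 0"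
  shows "gap a c s * (Gam 1 c s / 2) \<le> gam 1 c s"
proof -
  have "gap a c s * (Gam 1 c s / 2) \<le> gap 1 c s * (Gam 1 c s / 2)"
    using gap_le_gap_1[OF assms] Gam_pos[of 1 c s] assms by (intro mult_right_mono) auto
  also have "\<dots> = gam 1 c s" using Gam_pos[of 1 c s] assms by (simp add: gap_def)
  finally show ?thesis .
qed

lemma gap_Gam_less:
  assumes "a > 1" "c > 0" "s > 0"
  shows "gap a c s * (Gam 1 c s / 2) < gam 1 c s"
proof -
  have "gap a c s * (Gam 1 c s / 2) < gap 1 c s * (Gam 1 c s / 2)"
    using gap_less_gap_1[OF assms] Gam_pos[of 1 c s] assms by (intro mult_strict_right_mono) auto
  also have "\<dots> = gam 1 c s" using Gam_pos[of 1 c s] assms by (simp add: gap_def)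
  finally show ?thesis .
qed

lemma mult_sinh_nonneg: "r > 0 \<Longrightarrow> 0 \<le> b * sinh (b * r :: real)"
  by (cases "b \<ge> 0") (auto simp: zero_le_mult_iff mult_nonpos_nonneg)

lemma mult_sinh_pos: "r > 0 \<Longrightarrow> b \<noteq> 0 \<Longrightarrow> 0 < b * sinh (b * r :: real)"
  by (auto simp: zero_less_mult_iff mult_less_0_iff)

lemma line_gain_nonneg:
  assumes "a \<ge> 1" "c > 0" "r > 0" shows "0 \<le> line_gain a c b r"
proof -
  have "0 \<le> b * sinh (b * r) * (gap a c (r\<^sup>2))\<^sup>2 * (Gam 1 c (r\<^sup>2) / 2)"
    by (rule mult_nonneg_nonneg[OF mult_nonneg_nonneg[OF mult_sinh_nonneg[OF assms(3)] zero_le_power2]])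
      (use Gam_pos[of 1 c "r\<^sup>2"] assms in simp)
  moreover have "0 \<le> 2 * cosh (b * r) * (a * gap a c (r\<^sup>2) * (gap a c (r\<^sup>2) - (c - r\<^sup>2)) / r)
         * (gam 1 c (r\<^sup>2) - gap a c (r\<^sup>2) * (Gam 1 c (r\<^sup>2) / 2))"
    using assms gap_Gam_le[of a c "r\<^sup>2"] gap_gt[of a c "r\<^sup>2"] gap_pos[of a c "r\<^sup>2"]
    by (intro mult_nonneg_nonneg divide_nonneg_nonneg) auto
  ultimately show ?thesis unfolding line_gain_def by simp
qed

text \<open>If a > 1, the second term is positive by the strict comparison with
  \<open>gap 1\<close>; otherwise b is nonzero and the first term is positive.\<close>

lemma line_gain_pos:
  assumes "a \<ge> 1" "c > 0" "r > 0" "a > 1 \<or> b \<noteq> 0" shows "0 < line_gain a c b r"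
proof -
  have r: "r\<^sup>2 > 0" using assms by simp
  have 1: "0 \<le> 2 * cosh (b * r) * (a * gap a c (r\<^sup>2) * (gap a c (r\<^sup>2) - (c - r\<^sup>2)) / r)
         * (gam 1 c (r\<^sup>2) - gap a c (r\<^sup>2) * (Gam 1 c (r\<^sup>2) / 2))"
    using assms gap_Gam_le[of a c "r\<^sup>2"] gap_gt[of a c "r\<^sup>2"] gap_pos[of a c "r\<^sup>2"]
    by (intro mult_nonneg_nonneg divide_nonneg_nonneg) auto
  have 2: "0 \<le> b * sinh (b * r) * (gap a c (r\<^sup>2))\<^sup>2 * (Gam 1 c (r\<^sup>2) / 2)"
    by (rule mult_nonneg_nonneg[OF mult_nonneg_nonneg[OF mult_sinh_nonneg[OF assms(3)] zero_le_power2]])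
      (use Gam_pos[of 1 c "r\<^sup>2"] assms in simp)
  show ?thesis
  proof (cases "a > 1")
    case True
    have "0 < 2 * cosh (b * r) * (a * gap a c (r\<^sup>2) * (gap a c (r\<^sup>2) - (c - r\<^sup>2)) / r)
         * (gam 1 c (r\<^sup>2) - gap a c (r\<^sup>2) * (Gam 1 c (r\<^sup>2) / 2))"
      using assms True gap_Gam_less[of a c "r\<^sup>2"] gap_gt[of a c "r\<^sup>2"] gap_pos[of a c "r\<^sup>2"]
      by (intro mult_pos_pos divide_pos_pos) auto
    with 2 show ?thesis unfolding line_gain_def by linarith
  next
    case False
    have "0 < b * sinh (b * r) * (gap a c (r\<^sup>2))\<^sup>2 * (Gam 1 c (r\<^sup>2) / 2)"
      by (rule mult_pos_pos[OF mult_pos_pos[OF mult_sinh_pos]])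
        (use assms False Gam_pos[of 1 c "r\<^sup>2"] gap_pos[of a c "r\<^sup>2"] in auto)
    with 1 show ?thesis unfolding line_gain_def by linarith
  qed
qed

text \<open>Completing the square splits the squared distance into its parts along the line and
  orthogonal to it, the latter being \<open>t - b\<^sup>2\<close>.\<close>

lemma line_loss_nonneg:
  assumes "b\<^sup>2 \<le> t" "r > 0" shows "0 \<le> line_loss c b t d r"
proof -
  have "d\<^sup>2 - 2 * d * b + t = (d - b)\<^sup>2 + (t - b\<^sup>2)" "d\<^sup>2 + 2 * d * b + t = (d + b)\<^sup>2 + (t - b\<^sup>2)"
    by (simp_all add: power2_eq_square algebra_simps)
  then have "0 \<le> d\<^sup>2 - 2 * d * b + t" "0 \<le> d\<^sup>2 + 2 * d * b + t"
    using assms(1) by (metis add_nonneg_nonneg diff_ge_0_iff_ge zero_le_power2)+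
  then show ?thesis
    using assms unfolding line_loss_def by (simp add: gam_nonneg)
qed

section \<open>The antiderivative along a line and its boundary values\<close>

lemma continuous_on_gam_square [continuous_intros]:
  assumes "a > 0" "c > 0"
  shows "continuous_on {0<..} (\<lambda>r. gam a c (r\<^sup>2))"
  by (rule continuous_on_compose2[OF continuous_on_gam[OF assms]]) (auto intro!: continuous_intros)

lemma continuous_on_Gam_square [continuous_intros]:
  assumes "a > 0" "c > 0"
  shows "continuous_on {0<..} (\<lambda>r. Gam a c (r\<^sup>2))"
  by (rule continuous_on_compose2[OF continuous_on_Gam[OF assms]]) (auto intro!: continuous_intros)

lemma continuous_on_gap_square [continuous_intros]:
  assumes "a > 0" "c > 0"
  shows "continuous_on {0<..} (\<lambda>r. gap a c (r\<^sup>2))"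
  unfolding gap_def using Gam_pos[OF assms] assms
  by (intro continuous_intros) (auto simp: less_imp_neq[symmetric])

lemma gam_square_deriv:
  assumes "r > 0"
  shows "((\<lambda>r. gam 1 c (r\<^sup>2)) has_real_derivative (c - r\<^sup>2) * gam 1 c (r\<^sup>2) / r) (at r)"
proof -
  have "((\<lambda>r. gam 1 c (r\<^sup>2)) has_real_derivative
      1 / 2 * (c - r\<^sup>2) * (gam 1 c (r\<^sup>2) / r\<^sup>2) * (2 * r)) (at r)"
    by (rule DERIV_chain2[OF gam_deriv]) (use assms in \<open>auto intro!: derivative_eq_intros\<close>)
  then show ?thesis using assms by (simp add: power2_eq_square)
qed

lemma Gam_square_deriv:
  assumes "c > 0" "r > 0"
  shows "((\<lambda>r. Gam 1 c (r\<^sup>2)) has_real_derivative 2 * gam 1 c (r\<^sup>2) / r) (at r)"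
proof -
  have "((\<lambda>r. Gam 1 c (r\<^sup>2)) has_real_derivative gam 1 c (r\<^sup>2) / r\<^sup>2 * (2 * r)) (at r)"
    by (rule DERIV_chain2[OF Gam_deriv]) (use assms in \<open>auto intro!: derivative_eq_intros\<close>)
  then show ?thesis using assms by (simp add: power2_eq_square mult_ac)
qed

lemma gap_square_deriv:
  assumes "a > 0" "c > 0" "r > 0"
  shows "((\<lambda>r. gap a c (r\<^sup>2)) has_real_derivative
    a * gap a c (r\<^sup>2) * (c - r\<^sup>2 - gap a c (r\<^sup>2)) / r) (at r)"
proof -
  have "((\<lambda>r. gap a c (r\<^sup>2)) has_real_derivative
      a / 2 * gap a c (r\<^sup>2) * (c - r\<^sup>2 - gap a c (r\<^sup>2)) / r\<^sup>2 * (2 * r)) (at r)"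
    by (rule DERIV_chain2[OF gap_deriv]) (use assms in \<open>auto intro!: derivative_eq_intros\<close>)
  then show ?thesis using assms by (simp add: power2_eq_square mult_ac)
qed

text \<open>The difference of the losses of \<open>delta a\<close> and \<open>delta_JS\<close> along a line is \<open>- 2 k P' + k\<^sup>2 P / r\<close>, where
  \<open>k = gap a c (r\<^sup>2)\<close> and \<open>P = cosh (b r) P\<^sub>0\<close> with \<open>P\<^sub>0 = gam 1 c (r\<^sup>2)\<close>. Completing it to the derivative of
  \<open>cosh (b r) (k\<^sup>2 Q\<^sub>0 - 2 k P\<^sub>0)\<close>, with \<open>Q\<^sub>0 = Gam 1 c (r\<^sup>2) / 2\<close> and hence \<open>Q\<^sub>0' = P\<^sub>0 / r\<close>, leaves
  exactly \<open>- line_gain\<close>.\<close>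

definition line_pot :: "real \<Rightarrow> real \<Rightarrow> real \<Rightarrow> real \<Rightarrow> real" where
  "line_pot a c b r = cosh (b * r) *
     ((gap a c (r\<^sup>2))\<^sup>2 * (Gam 1 c (r\<^sup>2) / 2) - 2 * gap a c (r\<^sup>2) * gam 1 c (r\<^sup>2))"

lemma line_pot_deriv:
  assumes "a > 0" "c > 0" "r > 0"
  shows "(line_pot a c b has_real_derivative
     line_loss c b t (r - (c - gap a c (r\<^sup>2)) / r) r + line_gain a c b r - line_loss c b t (r - c / r) r) (at r)"
proof -
  define k P Q S C where "k = gap a c (r\<^sup>2)" and "P = gam 1 c (r\<^sup>2)" and "Q = Gam 1 c (r\<^sup>2)"
    and "S = sinh (b * r)" and "C = cosh (b * r)"
  define k' where "k' = a * k * (c - r\<^sup>2 - k) / r"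
  have gen: "((\<lambda>r. cosh (b * r) * ((f r)\<^sup>2 * (h r / 2) - 2 * f r * g r)) has_real_derivative
      b * S * ((f r)\<^sup>2 * (h r / 2) - 2 * f r * g r)
      + C * ((2 * f r * f' * (h r / 2) + (f r)\<^sup>2 * (h' / 2)) - (2 * f' * g r + 2 * f r * g'))) (at r)"
    if "(f has_real_derivative f') (at r)" "(g has_real_derivative g') (at r)"
      "(h has_real_derivative h') (at r)" for f g h :: "real \<Rightarrow> real" and f' g' h'
    using that by (auto intro!: derivative_eq_intros simp: S_def C_def algebra_simps)
  have "(line_pot a c b has_real_derivative
     b * S * (k\<^sup>2 * (Q / 2) - 2 * k * P)
     + C * ((2 * k * k' * (Q / 2) + k\<^sup>2 * (P / r)) - (2 * k' * P + 2 * k * ((c - r\<^sup>2) * P / r)))) (at r)"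
    using gen[OF gap_square_deriv[OF assms] gam_square_deriv[OF assms(3)]
        Gam_square_deriv[OF assms(2,3)]]
    unfolding line_pot_def[abs_def] k'_def k_def P_def Q_def by simp
  \<comment> \<open>The terms with k' combine to \<open>2 * C * (- k') * (P - k * (Q / 2))\<close>.
    Together with the term in S and Q they form the gain; the rest is the difference of
    losses.\<close>
  moreover have eq1: "b * S * (k\<^sup>2 * (Q / 2) - 2 * k * P)
     + C * ((2 * k * k' * (Q / 2) + k\<^sup>2 * (P / r)) - (2 * k' * P + 2 * k * ((c - r\<^sup>2) * P / r)))
    = (b * S * k\<^sup>2 * (Q / 2) + 2 * C * (- k') * (P - k * (Q / 2)))
      + k * P * (k / r - 2 * (c / r - r)) * C - 2 * b * k * P * S"
    using assms by (simp add: field_simps power2_eq_square)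
  moreover have eq2: "b * S * k\<^sup>2 * (Q / 2) + 2 * C * (- k') * (P - k * (Q / 2)) = line_gain a c b r"
  proof -
    have "- k' = a * k * (k - (c - r\<^sup>2)) / r" using assms by (simp add: k'_def field_simps)
    then show ?thesis by (simp add: line_gain_def k_def P_def Q_def S_def C_def)
  qed
  moreover have eq3: "line_loss c b t (r - (c - k) / r) r - line_loss c b t (r - c / r) r
     = k * P * (k / r - 2 * (c / r - r)) * C - 2 * b * k * P * S"
  proof -
    have l: "line_loss c b t d r = ((d\<^sup>2 + t) * C - 2 * d * b * S) * (r * P)" for d
      unfolding line_loss_def C_def S_def P_def cosh_def sinh_def by (simp add: field_simps)
    have diff: "line_loss c b t (x + y) r - line_loss c b t x r =
        ((2 * x * y + y\<^sup>2) * C - 2 * y * b * S) * (r * P)" for x y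
      unfolding l by (simp add: power2_eq_square algebra_simps)
    \<comment> \<open>Along the line the two estimators differ by k / r, so only terms linear and
      quadratic in this increment survive and t drops out.\<close>
    have eq: "r - (c - k) / r = (r - c / r) + k / r" by (simp add: diff_divide_distrib)
    have "line_loss c b t (r - (c - k) / r) r - line_loss c b t (r - c / r) r
      = ((2 * (r - c / r) * (k / r) + (k / r)\<^sup>2) * C - 2 * (k / r) * b * S) * (r * P)"
      unfolding eq by (rule trans[OF diff]) simp
    also have "\<dots> = k * P * (k / r - 2 * (c / r - r)) * C - 2 * b * k * P * S"
      using assms by (simp add: field_simps power2_eq_square)
    finally show ?thesis .
  qed
  ultimately show ?thesis
    unfolding k_def[symmetric] by (elim DERIV_cong) linarith
qed

text \<open>With 0 \<le> k Q \<le> P and 0 \<le> k \<le> c the bracket k (k Q - 2 P) is at most 2 c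
  P in absolute value. The bound is free of \<open>Gam\<close> and \<open>gap\<close>, so its limits
  are elementary.\<close>

lemma line_pot_bound:
  assumes "a \<ge> 1" "c > 0" "r > 0"
  shows "norm (line_pot a c b r) \<le> 2 * c * (exp ((\<bar>b\<bar> + 1) * r) * gam 1 c (r\<^sup>2))"
proof -
  define k P Q where "k = gap a c (r\<^sup>2)" and "P = gam 1 c (r\<^sup>2)" and "Q = Gam 1 c (r\<^sup>2) / 2"
  have k: "0 \<le> k" "k \<le> c" "0 \<le> P" "0 \<le> k * Q" "k * Q \<le> P"
    using assms gap_pos[of a c "r\<^sup>2"] gap_le[of a c "r\<^sup>2"] Gam_pos[of 1 c "r\<^sup>2"] gap_Gam_le[of a c "r\<^sup>2"]
    by (auto simp: k_def P_def Q_def gam_nonneg)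
  have "\<bar>k * (k * Q - 2 * P)\<bar> = k * \<bar>k * Q - 2 * P\<bar>" using k by (simp add: abs_mult)
  also have "\<dots> \<le> c * (2 * P)" using k by (intro mult_mono) auto
  finally have 1: "\<bar>k * (k * Q - 2 * P)\<bar> \<le> c * (2 * P)" .
  have e: "exp (b * r) \<le> exp ((\<bar>b\<bar> + 1) * r)" "exp (- (b * r)) \<le> exp ((\<bar>b\<bar> + 1) * r)"
    using assms by (auto simp: algebra_simps abs_if)
  then have 2: "cosh (b * r) \<le> exp ((\<bar>b\<bar> + 1) * r)"
    unfolding cosh_field_def using add_mono[OF e] by simp
  have "norm (line_pot a c b r) = cosh (b * r) * \<bar>k * (k * Q - 2 * P)\<bar>"
  proof -
    have "line_pot a c b r = cosh (b * r) * (k * (k * Q - 2 * P))"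
      unfolding line_pot_def by (simp add: k_def P_def Q_def power2_eq_square algebra_simps)
    then show ?thesis by (simp add: abs_mult)
  qed
  also have "\<dots> \<le> exp ((\<bar>b\<bar> + 1) * r) * (c * (2 * P))"
    using 1 2 by (intro mult_mono) auto
  finally show ?thesis by (simp add: P_def mult_ac)
qed

lemma line_pot_tendsto:
  assumes "a \<ge> 1" "c > 0"
  shows "(line_pot a c b \<longlongrightarrow> 0) (at_right 0)" "(line_pot a c b \<longlongrightarrow> 0) at_top"
proof -
  \<comment> \<open>The added 1 makes the exponential rate positive even for b = 0, so that the
    asymptotics need no case distinction.\<close>
  have B: "\<bar>b\<bar> + 1 > 0" by simp
  have "((\<lambda>r. exp (B * r) * gam 1 c (r\<^sup>2)) \<longlongrightarrow> 0) (at_right 0)"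
    "((\<lambda>r. exp (B * r) * gam 1 c (r\<^sup>2)) \<longlongrightarrow> 0) at_top" if "B > 0" for B :: real
    unfolding gam_def using assms that by real_asymp+
  note lims = this[OF B, THEN tendsto_mult_right_zero, of "2 * c"]
  show "(line_pot a c b \<longlongrightarrow> 0) (at_right 0)"
    by (rule Lim_null_comparison[OF eventually_mono[OF eventually_at_right_less] lims(1)])
      (use line_pot_bound[OF assms] in auto)
  show "(line_pot a c b \<longlongrightarrow> 0) at_top"
    by (rule Lim_null_comparison[OF eventually_mono[OF eventually_gt_at_top[of 0]] lims(2)])
      (use line_pot_bound[OF assms] in auto)
qed


text \<open>The antiderivative is \<open>line_pot\<close>. The gain is added to the smaller side,
  which keeps both integrands nonnegative.\<close>

lemma nn_integral_line_loss:
  assumes "a \<ge> 1" "c > 0" "b\<^sup>2 \<le> t"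
  shows "(\<integral>\<^sup>+r. ennreal (line_loss c b t (r - c / r) r) * indicator {0<..} r \<partial>lborel) =
    (\<integral>\<^sup>+r. ennreal (line_loss c b t (r - (c - gap a c (r\<^sup>2)) / r) r + line_gain a c b r) * indicator {0<..} r \<partial>lborel)"
proof (rule nn_integral_Ioi_eq_of_antiderivative)
  show "continuous_on {0<..} (\<lambda>r. line_loss c b t (r - c / r) r)"
    unfolding line_loss_def using assms by (intro continuous_intros) auto
  show "continuous_on {0<..} (\<lambda>r. line_loss c b t (r - (c - gap a c (r\<^sup>2)) / r) r + line_gain a c b r)"
    unfolding line_loss_def line_gain_def using assms by (intro continuous_intros) auto
qed (use assms line_pot_tendsto[OF assms(1,2), of b] line_pot_deriv[of a c _ b t]
  line_loss_nonneg[OF assms(3)] line_gain_nonneg[OF assms(1,2)] in \<open>auto intro!: add_nonneg_nonneg\<close>)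

section \<open>Risks\<close>

lemma measurable_gam [measurable]: "gam a c \<in> borel_measurable borel"
  unfolding gam_def by measurable

lemma measurable_Gam:
  assumes "a > 0" "c > 0" shows "Gam a c \<in> borel_measurable borel"
proof -
  have "(\<lambda>s. if s \<in> {0..} then Gam a c s else 0) \<in> borel_measurable borel"
    using continuous_on_Gam[OF assms] by (intro borel_measurable_continuous_on_if) auto
  \<comment> \<open>For negative s the interval \<open>{0..s}\<close> is empty, so
    \<open>Gam a c s = 0\<close>.\<close>
  also have "(\<lambda>s. if s \<in> {0..} then Gam a c s else 0) = Gam a c"
    by (auto simp: Gam_def)
  finally show ?thesis .
qed

lemma measurable_gap:
  assumes "a > 0" "c > 0" shows "gap a c \<in> borel_measurable borel"
proof -
  note [measurable] = measurable_Gam[OF assms]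
  show ?thesis unfolding gap_def by measurable
qed

lemma prod_Basis_vec: "(\<Prod>b\<in>Basis. f b :: 'b :: comm_monoid_mult) = (\<Prod>i\<in>UNIV. f (axis i 1 :: real ^ 'n))"
proof -
  have "Basis = range (\<lambda>i. axis i 1 :: real ^ 'n)"
    by (auto simp: Basis_vec_def)
  moreover have "inj (\<lambda>i. axis i 1 :: real ^ 'n)"
    by (auto simp: inj_on_def axis_eq_axis)
  ultimately show ?thesis
    using prod.reindex[of "\<lambda>i. axis i 1 :: real ^ 'n" UNIV f] by (simp add: comp_def)
qed

text \<open>The risk uses variance 1, whereas the majorant in \<open>risk_delta_finite\<close> has
  variance 2.\<close>

lemma prod_normal_density:
  fixes x \<theta> :: "real ^ 'n"
  shows "(\<Prod>i\<in>UNIV. normal_density (\<theta> $ i) \<sigma> (x $ i)) =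
    (1 / sqrt (2 * pi * \<sigma>\<^sup>2)) ^ CARD('n) * exp (- (norm (x - \<theta>))\<^sup>2 / (2 * \<sigma>\<^sup>2))"
proof -
  have "(norm (x - \<theta>))\<^sup>2 = (\<Sum>i\<in>UNIV. (x $ i - \<theta> $ i)\<^sup>2)"
    unfolding power2_norm_eq_inner inner_vec_def by (simp add: power2_eq_square)
  then show ?thesis
    by (simp add: normal_density_def prod.distrib prod_dividef exp_sum[symmetric] sum_negf sum_divide_distrib power_divide)
qed

lemma nn_integral_gaussian_finite:
  fixes \<theta> :: "real ^ 'n"
  assumes "\<sigma> > 0"
  shows "(\<integral>\<^sup>+x. ennreal (exp (- (norm (x - \<theta>))\<^sup>2 / (2 * \<sigma>\<^sup>2))) \<partial>lborel) < \<infinity>"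
proof -
  define K where "K = (1 / sqrt (2 * pi * \<sigma>\<^sup>2)) ^ CARD('n)"
  have K: "K > 0" using assms by (simp add: K_def)
  have "(\<integral>\<^sup>+x. ennreal (exp (- (norm (x - \<theta>))\<^sup>2 / (2 * \<sigma>\<^sup>2))) \<partial>lborel)
    = (\<integral>\<^sup>+x. ennreal (1 / K) * (\<Prod>b\<in>Basis. ennreal (normal_density (\<theta> \<bullet> b) \<sigma> (x \<bullet> b))) \<partial>lborel)"
  proof (rule nn_integral_cong)
    fix x :: "real ^ 'n"
    have "(\<Prod>b\<in>Basis. ennreal (normal_density (\<theta> \<bullet> b) \<sigma> (x \<bullet> b))) =
      ennreal (\<Prod>i\<in>UNIV. normal_density (\<theta> $ i) \<sigma> (x $ i))"
      by (simp add: prod_Basis_vec inner_axis prod_ennreal)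
    also have "\<dots> = ennreal (K * exp (- (norm (x - \<theta>))\<^sup>2 / (2 * \<sigma>\<^sup>2)))"
      unfolding prod_normal_density K_def ..
    finally show "ennreal (exp (- (norm (x - \<theta>))\<^sup>2 / (2 * \<sigma>\<^sup>2))) =
      ennreal (1 / K) * (\<Prod>b\<in>Basis. ennreal (normal_density (\<theta> \<bullet> b) \<sigma> (x \<bullet> b)))"
      using K by (simp add: ennreal_mult'[symmetric])
  qed
  also have "\<dots> = ennreal (1 / K) * (\<integral>\<^sup>+x. (\<Prod>b\<in>Basis. ennreal (normal_density (\<theta> \<bullet> b) \<sigma> (x \<bullet> b))) \<partial>lborel)"
    by (rule nn_integral_cmult) simp
  also have "(\<integral>\<^sup>+x. (\<Prod>b\<in>Basis. ennreal (normal_density (\<theta> \<bullet> b) \<sigma> (x \<bullet> b))) \<partial>lborel)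
    = (\<Prod>b\<in>Basis. \<integral>\<^sup>+x. ennreal (normal_density (\<theta> \<bullet> b) \<sigma> x) \<partial>lborel)"
    using nn_integral_lborel_prod[of "\<lambda>b. normal_density (\<theta> \<bullet> b) \<sigma>"] by (simp add: prod_ennreal)
  also have "\<dots> = 1"
    using assms by (simp add: nn_integral_eq_integral integral_normal_density)
  finally show ?thesis by simp
qed

lemma risk_eq:
  fixes \<theta> :: "real ^ 'n"
  assumes [measurable]: "\<delta> \<in> borel_measurable borel"
  shows "risk \<theta> \<delta> = (\<integral>\<^sup>+x. ennreal ((1 / sqrt (2 * pi)) ^ CARD('n) *
    ((norm (\<delta> x - \<theta>))\<^sup>2 * exp (- (norm (x - \<theta>))\<^sup>2 / 2))) \<partial>lborel)"
  unfolding risk_def normal_vec_def prod_normal_density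
  by (subst nn_integral_density) (auto intro!: nn_integral_cong simp: ennreal_mult'[symmetric] mult_ac)

lemma delta_eq:
  fixes x :: "real ^ 'n"
  assumes "CARD('n) \<ge> 3" "a > 0"
  shows "delta a x = (1 - ((real CARD('n) - 2) - gap a (real CARD('n) - 2) ((norm x)\<^sup>2)) / (norm x)\<^sup>2) *\<^sub>R x"
  using assms by (cases "x = 0") (auto simp: delta_def phi_eq)

text \<open>By \<open>gap_gt\<close> and \<open>gap_le\<close> the shrinkage factor lies between 0
  and 1, so the loss grows at most quadratically. Half of the Gaussian exponent absorbs this growth,
  leaving a Gaussian of variance 2.\<close>

lemma risk_delta_finite:
  fixes \<theta> :: "real ^ 'n"
  assumes "CARD('n) \<ge> 3" "a > 0" and [measurable]: "(delta a :: real ^ 'n \<Rightarrow> _) \<in> borel_measurable borel"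
  shows "risk \<theta> (delta a) < \<infinity>"
proof -
  define K where "K = (1 / sqrt (2 * pi)) ^ CARD('n)"
  have "K \<ge> 0" by (simp add: K_def)
  define c where "c = real CARD('n) - 2"
  have c: "c > 0" using assms by (simp add: c_def)
  define B where "B = K * (8 + 8 * (norm \<theta>)\<^sup>2)"
  have "B \<ge> 0" using \<open>K \<ge> 0\<close> by (simp add: B_def)
  have "K * ((norm (delta a x - \<theta>))\<^sup>2 * exp (- (norm (x - \<theta>))\<^sup>2 / 2))
      \<le> B * exp (- (norm (x - \<theta>))\<^sup>2 / (2 * (sqrt 2)\<^sup>2))" for x
  proof -
    define s where "s = (1 - (c - gap a c ((norm x)\<^sup>2)) / (norm x)\<^sup>2)"
    have "norm (delta a x) \<le> norm x"
    proof (cases "x = 0")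
      case False
      then have "0 \<le> s" "s \<le> 1"
        using gap_gt[OF assms(2) c, of "(norm x)\<^sup>2"] gap_le[OF assms(2) c, of "(norm x)\<^sup>2"]
        by (auto simp: s_def field_simps)
      then show ?thesis
        using delta_eq[OF assms(1,2), of x] by (simp add: s_def c_def mult_left_le_one_le)
    qed (simp add: delta_def)
    then have "norm (delta a x - \<theta>) \<le> norm (x - \<theta>) + 2 * norm \<theta>"
      using norm_triangle_ineq4[of "delta a x" \<theta>] norm_triangle_ineq2[of x \<theta>] by linarith
    then have "(norm (delta a x - \<theta>))\<^sup>2 \<le> (norm (x - \<theta>) + 2 * norm \<theta>)\<^sup>2"
      by (intro power_mono) auto
    also have "\<dots> \<le> 2 * (norm (x - \<theta>))\<^sup>2 + 8 * (norm \<theta>)\<^sup>2"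
      using zero_le_power2[of "norm (x - \<theta>) - 2 * norm \<theta>"] by (simp add: power2_eq_square algebra_simps)
    finally have 1: "(norm (delta a x - \<theta>))\<^sup>2 \<le> 2 * (norm (x - \<theta>))\<^sup>2 + 8 * (norm \<theta>)\<^sup>2" .
    define v where "v = (norm (x - \<theta>))\<^sup>2"
    have "v \<ge> 0" by (simp add: v_def)
    have e: "exp (- v / 2) = exp (- v / 4) * exp (- v / 4)" by (simp add: exp_add[symmetric])
    \<comment> \<open>This gives \<open>2 * v * exp (- v / 4) \<le> 8\<close>, the origin of the
      constant 8 in B.\<close>
    have "v / 4 \<le> exp (v / 4)" using exp_ge_add_one_self[of "v / 4"] by linarith
    then have "v / 4 * exp (- v / 4) \<le> exp (v / 4) * exp (- v / 4)" by (intro mult_right_mono) auto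
    then have "2 * v * exp (- v / 4) \<le> 8" by (simp add: exp_add[symmetric])
    moreover have "8 * (norm \<theta>)\<^sup>2 * exp (- v / 4) \<le> 8 * (norm \<theta>)\<^sup>2"
      using \<open>v \<ge> 0\<close> by (intro mult_left_le) auto
    ultimately have 2: "(2 * v + 8 * (norm \<theta>)\<^sup>2) * exp (- v / 4) \<le> 8 + 8 * (norm \<theta>)\<^sup>2"
      by (simp add: algebra_simps)
    have "(norm (delta a x - \<theta>))\<^sup>2 * exp (- v / 2) \<le> (2 * v + 8 * (norm \<theta>)\<^sup>2) * exp (- v / 2)"
      using 1 by (intro mult_right_mono) (auto simp: v_def)
    also have "\<dots> \<le> (8 + 8 * (norm \<theta>)\<^sup>2) * exp (- v / 4)"
      unfolding e mult.assoc[symmetric] using 2 by (intro mult_right_mono) auto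
    finally show ?thesis
      using \<open>K \<ge> 0\<close> by (simp add: v_def B_def mult.assoc mult_left_mono)
  qed
  then have "risk \<theta> (delta a) \<le> (\<integral>\<^sup>+x. ennreal (B * exp (- (norm (x - \<theta>))\<^sup>2 / (2 * (sqrt 2)\<^sup>2))) \<partial>lborel)"
    unfolding risk_eq[OF assms(3)] K_def[symmetric] by (intro nn_integral_mono ennreal_leI)
  also have "\<dots> = ennreal B * (\<integral>\<^sup>+x. ennreal (exp (- (norm (x - \<theta>))\<^sup>2 / (2 * (sqrt 2)\<^sup>2))) \<partial>lborel)"
    using \<open>B \<ge> 0\<close> by (simp add: ennreal_mult nn_integral_cmult)
  also have "\<dots> < \<infinity>"
    using nn_integral_gaussian_finite[of "sqrt 2" \<theta>] by (simp add: ennreal_mult_less_top)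
  finally show ?thesis .
qed

text \<open>Identifies the weight in \<open>line_loss\<close> as the polar factor times the radial
  part of the Gaussian density.\<close>

lemma gam_1_square:
  assumes "r > 0" "p \<ge> 2"
  shows "r * gam 1 (real p - 2) (r\<^sup>2) = r ^ (p - 1) * exp (- r\<^sup>2 / 2)"
proof -
  have "(r\<^sup>2) powr ((real p - 2) / 2) = r powr (real p - 2)"
  proof -
    have "2 * ((real p - 2) / 2) = real p - 2" by (simp add: field_simps)
    then have "(r powr 2) powr ((real p - 2) / 2) = r powr (real p - 2)"
      by (simp only: powr_powr)
    then show ?thesis using assms(1) by simp
  qed
  also have "\<dots> = r powr real (p - 2)" using assms by (simp add: of_nat_diff)
  also have "\<dots> = r ^ (p - 2)" by (rule powr_realpow[OF assms(1)])
  also have "r * r ^ (p - 2) = r ^ (p - 1)"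
    unfolding power_Suc[symmetric] using assms by (intro arg_cong[where f = "power r"]) auto
  finally show ?thesis
    by (simp add: gam_def mult.assoc[symmetric])
qed

lemma loss_on_line:
  fixes u \<theta> :: "'a::euclidean_space"
  assumes "norm u = 1" "r > 0" "DIM('a) \<ge> 2"
  shows "((norm (d *\<^sub>R u - \<theta>))\<^sup>2 * exp (- (norm (r *\<^sub>R u - \<theta>))\<^sup>2 / 2)
      + (norm (- (d *\<^sub>R u) - \<theta>))\<^sup>2 * exp (- (norm (- (r *\<^sub>R u) - \<theta>))\<^sup>2 / 2)) * r ^ (DIM('a) - 1)
    = 2 * exp (- (norm \<theta>)\<^sup>2 / 2) * line_loss (real DIM('a) - 2) (\<theta> \<bullet> u) ((norm \<theta>)\<^sup>2) d r"
proof -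
  define b t where "b = \<theta> \<bullet> u" and "t = (norm \<theta>)\<^sup>2"
  have n: "(norm (e *\<^sub>R u - \<theta>))\<^sup>2 = e\<^sup>2 - 2 * e * b + t" for e
  proof -
    have "u \<bullet> u = 1" using assms(1) by (simp add: dot_square_norm)
    then show ?thesis unfolding power2_norm_eq_inner b_def t_def
      by (simp add: algebra_simps inner_commute power2_eq_square)
  qed
  have n': "(norm (- (e *\<^sub>R u) - \<theta>))\<^sup>2 = e\<^sup>2 + 2 * e * b + t" for e
    using n[of "- e"] by simp
  have e: "exp (- (r\<^sup>2 - 2 * r * b + t) / 2) = exp (- t / 2) * exp (- r\<^sup>2 / 2) * exp (b * r)"
    "exp (- (r\<^sup>2 + 2 * r * b + t) / 2) = exp (- t / 2) * exp (- r\<^sup>2 / 2) * exp (- (b * r))"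
    unfolding exp_add[symmetric] by (simp_all add: field_simps)
  show ?thesis
    unfolding n n' e line_loss_def gam_1_square[OF assms(2,3)] b_def[symmetric] t_def[symmetric]
    by (simp add: algebra_simps)
qed

section \<open>From lines back to risks\<close>

lemma measurable_delta:
  assumes "CARD('n::finite) \<ge> 3" "a > 0"
  shows "(delta a :: real ^ 'n \<Rightarrow> real ^ 'n) \<in> borel_measurable borel"
proof -
  have [measurable]: "gap a (real CARD('n) - 2) \<in> borel_measurable borel"
    using assms by (intro measurable_gap) auto
  show ?thesis
    unfolding delta_eq[OF assms, abs_def] by measurable
qed

lemma measurable_delta_JS: "(delta_JS :: real ^ 'n \<Rightarrow> real ^ 'n) \<in> borel_measurable borel"
  unfolding delta_JS_def by measurable

text \<open>Carries \<open>line_gain\<close> from lines to a density on the whole space: dividing by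
  the polar factor undoes the polar weight, and the constants match those of
  \<open>loss_on_line\<close>.\<close>

definition gain :: "real \<Rightarrow> real ^ 'n \<Rightarrow> real ^ 'n \<Rightarrow> real" where
  "gain a \<theta> x = (1 / sqrt (2 * pi)) ^ CARD('n) * (exp (- (norm \<theta>)\<^sup>2 / 2) *
     line_gain a (real CARD('n) - 2) (\<theta> \<bullet> x / norm x) (norm x) / norm x ^ (CARD('n) - 1))"

lemma line_gain_minus: "line_gain a c (- b) r = line_gain a c b r"
  by (simp add: line_gain_def)

lemma gain_on_line:
  fixes \<theta> u :: "real ^ 'n"
  assumes "norm u = 1" "r > 0"
  shows "(gain a \<theta> (r *\<^sub>R u) + gain a \<theta> (- (r *\<^sub>R u))) * r ^ (CARD('n) - 1) =
    (1 / sqrt (2 * pi)) ^ CARD('n) * (2 * exp (- (norm \<theta>)\<^sup>2 / 2) * line_gain a (real CARD('n) - 2) (\<theta> \<bullet> u) r)"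
  using assms by (simp add: gain_def line_gain_minus)

lemma gain_nonneg:
  fixes \<theta> x :: "real ^ 'n"
  assumes "CARD('n) \<ge> 3" "a \<ge> 1"
  shows "0 \<le> gain a \<theta> x"
proof (cases "x = 0")
  case False
  then show ?thesis
    using assms unfolding gain_def by (auto intro!: mult_nonneg_nonneg divide_nonneg_nonneg line_gain_nonneg)
\<comment> \<open>At the origin the denominator is 0, hence so is the quotient.\<close>
qed (use assms in \<open>simp add: gain_def power_0_left\<close>)

lemma gain_pos:
  fixes \<theta> x :: "real ^ 'n"
  assumes "CARD('n) \<ge> 3" "a \<ge> 1" "x \<noteq> 0" "a > 1 \<or> \<theta> \<bullet> x \<noteq> 0"
  shows "0 < gain a \<theta> x"
  using assms unfolding gain_def
  by (intro mult_pos_pos divide_pos_pos line_gain_pos) auto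

lemma measurable_gain:
  fixes \<theta> :: "real ^ 'n"
  assumes "CARD('n) \<ge> 3" "a \<ge> 1"
  shows "gain a \<theta> \<in> borel_measurable borel"
proof -
  have [measurable]: "gap a (real CARD('n) - 2) \<in> borel_measurable borel"
    "Gam 1 (real CARD('n) - 2) \<in> borel_measurable borel"
    using assms by (auto intro!: measurable_gap measurable_Gam)
  show ?thesis
    unfolding gain_def line_gain_def cosh_field_def sinh_field_def by measurable
qed

text \<open>\<open>nn_integral_eq_on_lines\<close> reduces the claim to
  \<open>nn_integral_line_loss\<close> on each line. It is a sum rather than a difference because
  risks live in [0, \<infinity>].\<close>

lemma risk_delta_JS:
  fixes \<theta> :: "real ^ 'n"
  assumes "CARD('n) \<ge> 3" "a \<ge> 1"
  shows "risk \<theta> delta_JS = risk \<theta> (delta a) + (\<integral>\<^sup>+x. ennreal (gain a \<theta> x) \<partial>lborel)"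
proof -
  define c where "c = real CARD('n) - 2"
  have c: "c > 0" using assms by (simp add: c_def)
  define K where "K = (1 / sqrt (2 * pi)) ^ CARD('n)"
  have K: "K \<ge> 0" by (simp add: K_def)
  define w where "w = (\<lambda>\<delta> x. K * ((norm (\<delta> x - \<theta>))\<^sup>2 * exp (- (norm (x - \<theta>))\<^sup>2 / 2)))"
  have w_nonneg: "w \<delta> x \<ge> 0" for \<delta> x using K by (simp add: w_def)
  note [measurable] = measurable_delta_JS measurable_gain[OF assms, of \<theta>]
  have [measurable]: "(delta a :: real ^ 'n \<Rightarrow> real ^ 'n) \<in> borel_measurable borel"
    using assms by (intro measurable_delta) auto
  have [measurable]: "gap a c \<in> borel_measurable borel" "Gam 1 c \<in> borel_measurable borel"
    using assms c by (auto intro!: measurable_gap measurable_Gam)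
  have wm [measurable]: "w \<delta> \<in> borel_measurable borel" if [measurable]: "\<delta> \<in> borel_measurable borel" for \<delta>
    unfolding w_def by measurable
  have risk: "risk \<theta> \<delta> = (\<integral>\<^sup>+x. ennreal (w \<delta> x) \<partial>lborel)" if "\<delta> \<in> borel_measurable borel" for \<delta>
    using risk_eq[OF that] by (simp add: w_def K_def)
  have "(\<integral>\<^sup>+x. ennreal (w delta_JS x) \<partial>lborel) = (\<integral>\<^sup>+x. ennreal (w (delta a) x + gain a \<theta> x) \<partial>lborel)"
  proof (rule nn_integral_eq_on_lines)
    show "(\<lambda>x. ennreal (w delta_JS x)) \<in> borel_measurable borel"
      "(\<lambda>x. ennreal (w (delta a) x + gain a \<theta> x)) \<in> borel_measurable borel"
      by measurable
    fix u :: "real ^ 'n" assume u: "norm u = 1"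
    define b t where "b = \<theta> \<bullet> u" and "t = (norm \<theta>)\<^sup>2"
    define L where "L = K * (2 * exp (- t / 2))"
    have L: "L \<ge> 0" using K by (simp add: L_def)
    have "\<bar>b\<bar> \<le> norm \<theta>" using Cauchy_Schwarz_ineq2[of \<theta> u] u by (simp add: b_def)
    then have bt: "b\<^sup>2 \<le> t" by (simp add: t_def abs_le_square_iff[symmetric])
    \<comment> \<open>Both estimators are odd, so a single coefficient d describes the values at the
      two opposite points.\<close>
    have line: "(w \<delta> (r *\<^sub>R u) + w \<delta> (- (r *\<^sub>R u))) * r ^ (CARD('n) - 1) = L * line_loss c b t d r"
      if "r > 0" "\<delta> (r *\<^sub>R u) = d *\<^sub>R u" "\<delta> (- (r *\<^sub>R u)) = - (d *\<^sub>R u)" for \<delta> r d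
    proof -
      have "(w \<delta> (r *\<^sub>R u) + w \<delta> (- (r *\<^sub>R u))) * r ^ (CARD('n) - 1) =
        K * (((norm (d *\<^sub>R u - \<theta>))\<^sup>2 * exp (- (norm (r *\<^sub>R u - \<theta>))\<^sup>2 / 2)
      + (norm (- (d *\<^sub>R u) - \<theta>))\<^sup>2 * exp (- (norm (- (r *\<^sub>R u) - \<theta>))\<^sup>2 / 2)) * r ^ (DIM(real ^ 'n) - 1))"
        unfolding w_def that by (simp add: algebra_simps)
      also have "\<dots> = L * line_loss c b t d r"
        using assms by (subst loss_on_line[OF u that(1)]) (simp_all add: L_def c_def b_def t_def)
      finally show ?thesis .
    qed
    have shrink: "(1 - v / r\<^sup>2) * r = r - v / r" if "r > 0" for v r :: real
      using that by (simp add: field_simps power2_eq_square)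
    have JS: "(w delta_JS (r *\<^sub>R u) + w delta_JS (- (r *\<^sub>R u))) * r ^ (CARD('n) - 1) =
        L * line_loss c b t (r - c / r) r" if "r > 0" for r
      using that u shrink[of r c] by (intro line) (simp_all add: delta_JS_def c_def[symmetric])
    have da: "(w (delta a) (r *\<^sub>R u) + w (delta a) (- (r *\<^sub>R u))) * r ^ (CARD('n) - 1) =
        L * line_loss c b t (r - (c - gap a c (r\<^sup>2)) / r) r" if "r > 0" for r
      using that u assms shrink[of r "c - gap a c (r\<^sup>2)"]
      by (intro line) (simp_all add: delta_eq c_def[symmetric])
    have gn: "(gain a \<theta> (r *\<^sub>R u) + gain a \<theta> (- (r *\<^sub>R u))) * r ^ (CARD('n) - 1) = L * line_gain a c b r"
      if "r > 0" for r
      using gain_on_line[OF u that, of a \<theta>] by (simp add: L_def K_def c_def b_def t_def)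
    have "(\<integral>\<^sup>+r. (ennreal (w delta_JS (r *\<^sub>R u)) + ennreal (w delta_JS (- (r *\<^sub>R u)))) *
        ennreal (r ^ (DIM(real ^ 'n) - 1)) * indicator {0<..} r \<partial>lborel)
      = (\<integral>\<^sup>+r. ennreal L * (ennreal (line_loss c b t (r - c / r) r) * indicator {0<..} r) \<partial>lborel)"
    proof (rule nn_integral_cong)
      fix r :: real
      show "(ennreal (w delta_JS (r *\<^sub>R u)) + ennreal (w delta_JS (- (r *\<^sub>R u)))) *
        ennreal (r ^ (DIM(real ^ 'n) - 1)) * indicator {0<..} r
        = ennreal L * (ennreal (line_loss c b t (r - c / r) r) * indicator {0<..} r)"
        using JS[of r] L
        by (cases "r > 0") (simp_all add: ennreal_plus[symmetric] ennreal_mult'[symmetric] w_nonneg del: ennreal_plus)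
    qed
    also have "\<dots> = ennreal L * (\<integral>\<^sup>+r. ennreal (line_loss c b t (r - c / r) r) * indicator {0<..} r \<partial>lborel)"
      unfolding line_loss_def by (rule nn_integral_cmult) measurable
    also have "(\<integral>\<^sup>+r. ennreal (line_loss c b t (r - c / r) r) * indicator {0<..} r \<partial>lborel) =
      (\<integral>\<^sup>+r. ennreal (line_loss c b t (r - (c - gap a c (r\<^sup>2)) / r) r + line_gain a c b r) * indicator {0<..} r \<partial>lborel)"
      by (rule nn_integral_line_loss[OF assms(2) c bt])
    also have "ennreal L * \<dots> =
      (\<integral>\<^sup>+r. ennreal L * (ennreal (line_loss c b t (r - (c - gap a c (r\<^sup>2)) / r) r + line_gain a c b r) * indicator {0<..} r) \<partial>lborel)"
      unfolding line_loss_def line_gain_def cosh_field_def sinh_field_def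
      by (rule nn_integral_cmult[symmetric]) measurable
    also have "\<dots> = (\<integral>\<^sup>+r. (ennreal (w (delta a) (r *\<^sub>R u) + gain a \<theta> (r *\<^sub>R u)) +
          ennreal (w (delta a) (- (r *\<^sub>R u)) + gain a \<theta> (- (r *\<^sub>R u)))) *
        ennreal (r ^ (DIM(real ^ 'n) - 1)) * indicator {0<..} r \<partial>lborel)"
    proof (rule nn_integral_cong)
      fix r :: real
      show "ennreal L * (ennreal (line_loss c b t (r - (c - gap a c (r\<^sup>2)) / r) r + line_gain a c b r) * indicator {0<..} r)
        = (ennreal (w (delta a) (r *\<^sub>R u) + gain a \<theta> (r *\<^sub>R u)) +
          ennreal (w (delta a) (- (r *\<^sub>R u)) + gain a \<theta> (- (r *\<^sub>R u)))) *
        ennreal (r ^ (DIM(real ^ 'n) - 1)) * indicator {0<..} r"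
      proof (cases "r > 0")
        case True
        have "L * (line_loss c b t (r - (c - gap a c (r\<^sup>2)) / r) r + line_gain a c b r) =
          ((w (delta a) (r *\<^sub>R u) + gain a \<theta> (r *\<^sub>R u)) +
          (w (delta a) (- (r *\<^sub>R u)) + gain a \<theta> (- (r *\<^sub>R u)))) * r ^ (CARD('n) - 1)"
          using da[OF True] gn[OF True] by (simp add: algebra_simps)
        then show ?thesis
          using True L gain_nonneg[OF assms, of \<theta>]
          by (simp add: ennreal_plus[symmetric] ennreal_mult'[symmetric] w_nonneg del: ennreal_plus)
      qed simp
    qed
    finally show "(\<integral>\<^sup>+r. (ennreal (w delta_JS (r *\<^sub>R u)) + ennreal (w delta_JS (- (r *\<^sub>R u)))) *
        ennreal (r ^ (DIM(real ^ 'n) - 1)) * indicator {0<..} r \<partial>lborel)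
      = (\<integral>\<^sup>+r. (ennreal (w (delta a) (r *\<^sub>R u) + gain a \<theta> (r *\<^sub>R u)) +
          ennreal (w (delta a) (- (r *\<^sub>R u)) + gain a \<theta> (- (r *\<^sub>R u)))) *
        ennreal (r ^ (DIM(real ^ 'n) - 1)) * indicator {0<..} r \<partial>lborel)" .
  qed
  then show ?thesis
    using gain_nonneg[OF assms, of \<theta>]
    by (simp add: risk nn_integral_add w_nonneg)
qed

text \<open>The gain is positive almost everywhere: if a = 1, it can vanish only at the origin or on
  the hyperplane orthogonal to \<theta>, which is a null set as \<theta> is nonzero. Hence its
  integral is nonzero.\<close>

lemma risk_delta_less:
  fixes \<theta> :: "real ^ 'n"
  assumes "CARD('n) \<ge> 3" "a \<ge> 1" "a > 1 \<or> \<theta> \<noteq> 0"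
  shows "risk \<theta> (delta a) < risk \<theta> delta_JS"
proof -
  note [measurable] = measurable_gain[OF assms(1,2), of \<theta>]
  have fin: "risk \<theta> (delta a) < \<infinity>"
    using assms by (intro risk_delta_finite measurable_delta) auto
  have "AE x in lborel. a > 1 \<or> \<theta> \<bullet> x \<noteq> 0"
  proof (cases "a > 1")
    case False
    with assms have "negligible {x. \<theta> \<bullet> x = 0}" by (intro negligible_hyperplane) auto
    moreover have "{x. \<theta> \<bullet> x = 0} \<in> sets lborel" by measurable
    ultimately have "{x. \<theta> \<bullet> x = 0} \<in> null_sets lborel"
      by (simp add: negligible_iff_null_sets null_sets_completion_iff)
    from AE_not_in[OF this] show ?thesis by eventually_elim auto
  qed simp
  then have pos: "AE x in lborel. gain a \<theta> x > 0"
    using AE_lborel_singleton[of "0 :: real ^ 'n"]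
    by eventually_elim (use gain_pos[OF assms(1,2)] in auto)
  have "(\<integral>\<^sup>+x. ennreal (gain a \<theta> x) \<partial>lborel) \<noteq> 0"
  proof
    assume "(\<integral>\<^sup>+x. ennreal (gain a \<theta> x) \<partial>lborel) = 0"
    then have "AE x in lborel. ennreal (gain a \<theta> x) = 0"
      by (subst (asm) nn_integral_0_iff_AE) auto
    with pos have "AE x in (lborel :: (real ^ 'n) measure). False"
      by eventually_elim auto
    then show False
      by (simp add: trivial_limit_def[symmetric] ae_filter_eq_bot_iff eventually_False)
  qed
  \<comment> \<open>Cancelling \<open>risk \<theta> (delta a)\<close> is legitimate because it is
    finite.\<close>
  then have "risk \<theta> (delta a) + 0 \<noteq> risk \<theta> (delta a) + (\<integral>\<^sup>+x. ennreal (gain a \<theta> x) \<partial>lborel)"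
    using fin by (subst ennreal_add_left_cancel) auto
  then show ?thesis
    unfolding risk_delta_JS[OF assms(1,2)] by (simp add: order.strict_iff_order)
qed

section \<open>The limit of the estimators and the conclusion\<close>

lemma delta_tendsto:
  fixes x :: "real ^ 'n"
  assumes "CARD('n) \<ge> 3" "x \<noteq> 0"
  shows "((\<lambda>a. delta a x) \<longlongrightarrow> delta_JS_plus x) at_top"
proof -
  define c s where "c = real CARD('n) - 2" and "s = (norm x)\<^sup>2"
  have c: "c > 0" "s > 0" using assms by (simp_all add: c_def s_def)
  have "((\<lambda>a. (1 - (c - gap a c s) / s) *\<^sub>R x) \<longlongrightarrow> (1 - (c - max 0 (c - s)) / s) *\<^sub>R x) at_top"
    using c by (intro tendsto_intros gap_tendsto) auto
  moreover have "\<forall>\<^sub>F a in at_top. (1 - (c - gap a c s) / s) *\<^sub>R x = delta a x"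
    using eventually_gt_at_top[of 0] by eventually_elim (use assms in \<open>simp add: delta_eq c_def s_def\<close>)
  moreover have "1 - (c - max 0 (c - s)) / s = max 0 (1 - c / s)"
    using c by (simp add: max_def field_simps)
  ultimately show ?thesis
    unfolding delta_JS_plus_def c_def[symmetric] s_def[symmetric]
    by (simp add: tendsto_cong)
qed

theorem theorem3p2:
  assumes "CARD('n::finite) \<ge> 3"
  shows "(\<forall>\<alpha>\<ge>1. dominates (delta \<alpha> :: real ^ 'n \<Rightarrow> real ^ 'n) delta_JS)
    \<and> (\<forall>\<alpha>>1. risk (0 :: real ^ 'n) (delta \<alpha>) < risk (0 :: real ^ 'n) delta_JS)
    \<and> (\<forall>x :: real ^ 'n. x \<noteq> 0 \<longrightarrow> ((\<lambda>\<alpha>. delta \<alpha> x) \<longlongrightarrow> delta_JS_plus x) at_top)"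
proof (intro conjI allI impI)
  fix \<alpha> :: real assume "\<alpha> \<ge> 1"
  then show "dominates (delta \<alpha> :: real ^ 'n \<Rightarrow> real ^ 'n) delta_JS"
    \<comment> \<open>The all-ones vector witnesses strictness; being nonzero, it also covers
      \<open>\<alpha> = 1\<close>, where the gain at \<theta> = 0 vanishes.\<close>
    unfolding dominates_def using risk_delta_JS[OF assms] risk_delta_less[OF assms, of \<alpha> 1] by auto
qed (use risk_delta_less[OF assms] delta_tendsto[OF assms] in auto)

end
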